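(* Let $\mathcal{C}:\mathcal{P}(\mathbb{R}^n)\to[0,\infty]$ be an outer capacity which satisfies the packing assumption (P) and is doubling. Let $Q_0\in\mathcal{D}(Q)$. Then there exist constants $a,A>0$ such that $$\mathcal{C}\left(\{x\in Q':|f(x)-c_{Q'}|>t\}\right)\le A\,\mathcal{C}(Q')\exp\left(-at/\|f\|_{BMO^{\mathcal{C}}(Q_0)}\right)$$ for every $t>0$, every $f\in BMO^{\mathcal{C}}(Q_0)$, and every finite subcube $Q'\in\mathcal{D}(Q_0)$, where $$c_{Q'}=\operatorname*{arg\,min}_{c\in\mathbb{R}}\frac{1}{\mathcal{C}(Q')}\int_{Q'}|f-c|\,d\mathcal{C}.$$
   Context: Outer capacity: a set function $\mathcal{C}:\mathcal{P}(\mathbb{R}^n)\to[0,\infty]$ with $\mathcal{C}(\emptyset)=0$; $A\subset B\Rightarrow\mathcal{C}(A)\le\mathcal{C}(B)$; $A\subset\bigcup_{i=1}^\infty A_i\Rightarrow\mathcal{C}(A)\le\sum_i\mathcal{C}(A_i)$; and $\mathcal{C}(A)=\inf\{\mathcal{C}(U): A\subset U,\ U\text{ open}\}$. Doubling: there is $D_0>0$ with $\mathcal{C}(B(x,2r))\le D_0\,\mathcal{C}(B(x,r))$ for all $x\in\mathbb{R}^n$, $r>0$, where $B(x,r)$ is the open ball. Dyadic cubes. Fix a half-open cube $Q=[x_1,x_1+\ell)\times\cdots\times[x_n,x_n+\ell)\subset\mathbb{R}^n$, $\ell>0$, and put $x_Q=(x_1,\dots,x_n)$. Let $\mathcal{D}_0(Q)=\{x_Q+2^k\ell(m+[0,1)^n):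 k\in\mathbb{Z}, m\in\mathbb{Z}^n\}$ and $\mathcal{D}(Q)=\mathcal{D}_0(Q)\cup\{\prod_{i=1}^n I_i: I_i=[x_i,\infty)\text{ or }(-\infty,x_i)\}$ (cubes in $\mathcal{D}_0(Q)$ are finite, the others infinite). For $Q_0\in\mathcal{D}(Q)$ (possibly infinite), $\mathcal{D}(Q_0)$ here denotes the set of cubes $Q'\in\mathcal{D}(Q)$ with $Q'\subset Q_0$. Choquet integral. $\int_A f\,d\mathcal{C}=\int_0^\infty\mathcal{C}(\{x\in A: f(x)>t\})\,dt$ for $f\ge0$. Convention: $0\cdot\infty=0$, and an average over a set of zero capacity is $0$. Packing assumption (P): there is a constant $A_0\ge1$ such that for every non-overlapping collection $\{Q_j\}\subset\mathcal{D}(Q)$ satisfying $\sum_{Q_j\subset Q'}\mathcal{C}(Q_j)\le A_0\,\mathcal{C}(Q')$ for every $Q'\in\mathcal{D}(Q)$, one has $\sum_j\int_{Q_j}f\,d\mathcal{C}\le A_0\int_{\cup_jQ_j}f\,d\mathcal{C}$ for every $f:\mathbb{R}^n\to[0,\infty]$. BMO. For real-valued $f$ on $Q_0$, $\mathcal{M}^{\#}_{\mathcal{C}}f(x)=\sup_{x\in Q'\in\mathcal{D}(Q_0)}\inf_{c\in\mathbb{R}}\frac{1}{\mathcal{C}(Q')}\int_{Q'}|f-c|\,d\mathcal{C}$, $\|f\|_{BMO^{\mathcal{C}}(Q_0)}=\|\mathcal{M}^{\#}_{\mathcal{C}}f\|_{L^\infty(Q_0)}$, and $f\in BMO^{\mathcal{C}}(Q_0)$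 means this is finite. If the norm is $0$, the exponential is read as $0$. $c_{Q'}$ denotes a minimizer.
   Formalization: The capacity is additionally assumed finite on some nonempty set; this excludes only the capacity equal to ∞ on every nonempty set, for which all averages are 0, every norm is 0, and the stated inequality fails for nonconstant f. *)

theory Defs
  imports "HOL-Probability.Essential_Supremum"
begin

definition outer_capacity :: "(('a::topological_space) set \<Rightarrow> ennreal) \<Rightarrow> bool" where
  "outer_capacity C \<longleftrightarrow>
     C {} = 0 \<and>
     (\<forall>A B. A \<subseteq> B \<longrightarrow> C A \<le> C B) \<and>
     (\<forall>A (F :: nat \<Rightarrow> 'a set). A \<subseteq> (\<Union>i. F i) \<longrightarrow> C A \<le> (\<Sum>i. C (F i))) \<and>
     (\<forall>A. C A = (INF U\<in>{U. A \<subseteq> U \<and> open U}. C U))"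

definition doubling_capacity :: "(('a::metric_space) set \<Rightarrow> ennreal) \<Rightarrow> bool" where
  "doubling_capacity C \<longleftrightarrow>
     (\<exists>D0::real. D0 > 0 \<and>
        (\<forall>x r. r > 0 \<longrightarrow> C (ball x (2 * r)) \<le> ennreal D0 * C (ball x r)))"

text \<open>The base cube is the half-open cube with corner \<open>xQ\<close> and side length \<open>l\<close>, so it enters the
  definitions only through these two parameters.\<close>

definition finite_dyadic_cubes :: "real ^ 'n \<Rightarrow> real \<Rightarrow> (real ^ 'n) set set" where
  "finite_dyadic_cubes xQ l =
     {P. \<exists>(k::int) (m :: int ^ 'n).
        P = {xQ + (2 powi k * l) *\<^sub>R ((\<chi> i. real_of_int (m $ i)) + u) | u.
               \<forall>i. 0 \<le> u $ i \<and> u $ i < 1}}"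

definition infinite_dyadic_cubes :: "real ^ 'n \<Rightarrow> (real ^ 'n) set set" where
  "infinite_dyadic_cubes xQ =
     {P. \<exists>I :: 'n \<Rightarrow> real set.
        (\<forall>i. I i = {xQ $ i..} \<or> I i = {..<xQ $ i}) \<and> P = {y. \<forall>i. y $ i \<in> I i}}"

definition dyadic_cubes :: "real ^ 'n \<Rightarrow> real \<Rightarrow> (real ^ 'n) set set" where
  "dyadic_cubes xQ l = finite_dyadic_cubes xQ l \<union> infinite_dyadic_cubes xQ"

definition dyadic_subcubes :: "real ^ 'n \<Rightarrow> real \<Rightarrow> (real ^ 'n) set \<Rightarrow> (real ^ 'n) set set" where
  "dyadic_subcubes xQ l Q0 = {P \<in> dyadic_cubes xQ l. P \<subseteq> Q0}"

definition choquet :: "('a set \<Rightarrow> ennreal) \<Rightarrow> 'a set \<Rightarrow> ('a \<Rightarrow> ennreal) \<Rightarrow> ennreal" where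
  "choquet C A f = (\<integral>\<^sup>+ t \<in> {0..}. C {x \<in> A. f x > ennreal t} \<partial>lborel)"

text \<open>Division in \<^typ>\<open>ennreal\<close> is multiplication by the inverse, with \<open>inverse 0 = \<infinity>\<close>,
  \<open>inverse \<infinity> = 0\<close> and \<open>0 * \<infinity> = 0\<close>. For monotone \<open>C\<close> with \<open>C A = 0\<close> the integral vanishes, so the
  average over a set of zero capacity is 0.\<close>

definition choquet_average :: "('a set \<Rightarrow> ennreal) \<Rightarrow> 'a set \<Rightarrow> ('a \<Rightarrow> ennreal) \<Rightarrow> ennreal" where
  "choquet_average C A f = choquet C A f / C A"

definition non_overlapping :: "('a::topological_space) set set \<Rightarrow> bool" where
  "non_overlapping \<F> \<longleftrightarrow> pairwise (\<lambda>P R. interior P \<inter> interior R = {}) \<F>"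

definition packing_assumption ::
  "((real ^ 'n) set \<Rightarrow> ennreal) \<Rightarrow> real ^ 'n \<Rightarrow> real \<Rightarrow> bool" where
  "packing_assumption C xQ l \<longleftrightarrow>
     (\<exists>A0::real. A0 \<ge> 1 \<and>
        (\<forall>\<F> \<subseteq> dyadic_cubes xQ l.
           non_overlapping \<F> \<longrightarrow>
           (\<forall>Q' \<in> dyadic_cubes xQ l. (\<Sum>\<^sub>\<infinity>P\<in>{P \<in> \<F>. P \<subseteq> Q'}. C P) \<le> ennreal A0 * C Q') \<longrightarrow>
           (\<forall>f :: real ^ 'n \<Rightarrow> ennreal.
              (\<Sum>\<^sub>\<infinity>P\<in>\<F>. choquet C P f) \<le> ennreal A0 * choquet C (\<Union>\<F>) f)))"

definition mean_deviation ::
  "('a set \<Rightarrow> ennreal) \<Rightarrow> 'a set \<Rightarrow> ('a \<Rightarrow> real) \<Rightarrow> real \<Rightarrow> ennreal" where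
  "mean_deviation C P f c = choquet_average C P (\<lambda>x. ennreal \<bar>f x - c\<bar>)"

definition sharp_maximal ::
  "((real ^ 'n) set \<Rightarrow> ennreal) \<Rightarrow> real ^ 'n \<Rightarrow> real \<Rightarrow> (real ^ 'n) set \<Rightarrow>
     (real ^ 'n \<Rightarrow> real) \<Rightarrow> real ^ 'n \<Rightarrow> ennreal" where
  "sharp_maximal C xQ l Q0 f x =
     (SUP P\<in>{P \<in> dyadic_subcubes xQ l Q0. x \<in> P}. INF c. mean_deviation C P f c)"

text \<open>The supremum runs over countably many cubes \<open>P\<close>, each contributing a constant times the
  indicator of \<open>P\<close>. Hence the sharp maximal function is Borel, and the value \<open>\<infinity>\<close> that \<^const>\<open>esssup\<close>
  takes at non-measurable functions does not arise. Every cube has positive Lebesgue measure and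
  cubes of zero capacity contribute 0, so the Lebesgue essential supremum, the capacitary essential
  supremum and the pointwise supremum coincide.\<close>

definition bmo_norm ::
  "((real ^ 'n) set \<Rightarrow> ennreal) \<Rightarrow> real ^ 'n \<Rightarrow> real \<Rightarrow> (real ^ 'n) set \<Rightarrow>
     (real ^ 'n \<Rightarrow> real) \<Rightarrow> ennreal" where
  "bmo_norm C xQ l Q0 f = esssup (lebesgue_on Q0) (sharp_maximal C xQ l Q0 f)"

definition BMO ::
  "((real ^ 'n) set \<Rightarrow> ennreal) \<Rightarrow> real ^ 'n \<Rightarrow> real \<Rightarrow> (real ^ 'n) set \<Rightarrow>
     (real ^ 'n \<Rightarrow> real) set" where
  "BMO C xQ l Q0 = {f. bmo_norm C xQ l Q0 f < \<infinity>}"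

definition exp_decay :: "real \<Rightarrow> real \<Rightarrow> ennreal \<Rightarrow> ennreal" where
  "exp_decay a t N = (if N = 0 then 0 else ennreal (exp (- a * t / enn2real N)))"

end

theory Submission
  imports Defs
begin

text \<open>Calderon-Zygmund stopping is run directly on the level set \<open>E = {x \<in> P. \<bar>f x - c\<bar> > s}\<close>: one stops
  at the maximal cubes \<open>R\<close> with \<open>C (E \<inter> R) > d * C R\<close>. In place of Lebesgue differentiation, which is
  not available for arbitrary \<open>f\<close>, one uses that a set \<open>Z\<close> with \<open>C (Z \<inter> R) \<le> d * C R\<close> for every cube \<open>R\<close>
  meeting \<open>Z\<close> is null for small \<open>d\<close>: cover it by an open set of nearly the same capacity and apply
  the packing assumption to a packed subfamily of the dyadic cubes in the open set.

  A packed subfamily of the stopping cubes, with the packing assumption applied to the indicator of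
  \<open>E\<close>, yields disjoint cubes covering almost all of \<open>E\<close> whose capacities sum to at most
  \<open>C P / 2\<close>. By doubling, \<open>E\<close> fills at most a quarter of each of them, so near-minimizers there
  differ from \<open>c\<close> by at most a fixed multiple of the norm, and iterating gives exponential decay.\<close>

subsection \<open>Sums and outer capacities\<close>

lemma sum_le_infsum_ennreal:
  fixes f :: "'a \<Rightarrow> ennreal"
  assumes "finite F" "F \<subseteq> A"
  shows "sum f F \<le> infsum f A"
  using assms by (subst nonneg_infsum_complete) (auto intro!: SUP_upper)

lemma infsum_le_ennreal:
  fixes f :: "'a \<Rightarrow> ennreal"
  assumes "\<And>F. finite F \<Longrightarrow> F \<subseteq> A \<Longrightarrow> sum f F \<le> b"
  shows "infsum f A \<le> b"
  using assms by (subst nonneg_infsum_complete) (auto intro!: SUP_least)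

lemma infsum_cmult_le_ennreal:
  fixes f :: "'a \<Rightarrow> ennreal"
  shows "(\<Sum>\<^sub>\<infinity>x\<in>A. c * f x) \<le> c * infsum f A"
  by (rule infsum_le_ennreal)
    (auto simp flip: sum_distrib_left intro!: mult_left_mono sum_le_infsum_ennreal)

text \<open>As \<open>y\<close> is less than half of \<open>x\<close>, the other summand carries at
  least half. In \<open>packed_selection\<close> this absorbs the cube left out into the sum over
  the selected ones.\<close>

lemma le_double_of_half_le:
  fixes x y z :: ennreal
  assumes "x \<le> y + z" "2 * y < x" "x < \<infinity>"
  shows "x \<le> 2 * z"
proof -
  obtain a where a: "x = ennreal a" "a \<ge> 0" using assms(3) by (cases x) auto
  have "y \<noteq> top" using assms(2) by (auto simp: ennreal_mult_top)
  then obtain b where b: "y = ennreal b" "b \<ge> 0" by (cases y) auto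
  show ?thesis
  proof (cases z)
    case (real c)
    have 2: "2 * ennreal r = ennreal (2 * r)" if "r \<ge> 0" for r
      using that by (simp add: ennreal_mult)
    have "a \<le> b + c" "2 * b < a"
      using assms a b real by (simp_all add: 2 ennreal_less_iff flip: ennreal_plus)
    then show ?thesis using a real by (simp add: 2)
  qed (simp add: ennreal_mult_top)
qed

text \<open>A nonempty member of \<open>S\<close> lies in at most one member of the disjoint family
  \<open>H\<close>, so no term is counted twice.\<close>

lemma sum_infsum_disjoint_le:
  fixes f :: "'a set \<Rightarrow> ennreal"
  assumes "finite H" "pairwise disjnt H" "\<And>R. R \<in> S \<Longrightarrow> R \<noteq> {}"
  shows "(\<Sum>X\<in>H. infsum f {R \<in> S. R \<subseteq> X}) \<le> infsum f S"
proof -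
  have "(\<Sum>X\<in>H. infsum f {R \<in> S. R \<subseteq> X}) = infsum f {R \<in> S. \<exists>X\<in>H. R \<subseteq> X}"
    using assms(1,2)
  proof (induction H)
    case (insert Y H)
    have disj: "{R \<in> S. R \<subseteq> Y} \<inter> {R \<in> S. \<exists>X\<in>H. R \<subseteq> X} = {}"
    proof -
      have False if "R \<in> S" "R \<subseteq> Y" "X \<in> H" "R \<subseteq> X" for R X
      proof -
        have "Y \<inter> X = {}"
          using insert.prems insert.hyps that by (auto simp: pairwise_insert disjnt_def)
        then show False using that assms(3) by blast
      qed
      then show ?thesis by blast
    qed
    have "infsum f {R \<in> S. R \<subseteq> Y} + infsum f {R \<in> S. \<exists>X\<in>H. R \<subseteq> X} =
      infsum f ({R \<in> S. R \<subseteq> Y} \<union> {R \<in> S. \<exists>X\<in>H. R \<subseteq> X})"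
      using disj by (intro infsum_Un_disjoint[symmetric] nonneg_summable_on_complete) simp_all
    also have "{R \<in> S. R \<subseteq> Y} \<union> {R \<in> S. \<exists>X\<in>H. R \<subseteq> X} = {R \<in> S. \<exists>X\<in>insert Y H. R \<subseteq> X}"
      by auto
    finally show ?case
      using insert by (simp add: pairwise_insert)
  qed simp
  also have "\<dots> \<le> infsum f S"
    by (rule infsum_mono_neutral) (auto intro: nonneg_summable_on_complete)
  finally show ?thesis .
qed

section \<open>Consequences of the axioms of an outer capacity\<close>

lemma outer_capacity_empty: "outer_capacity C \<Longrightarrow> C {} = 0"
  unfolding outer_capacity_def by blast

lemma outer_capacity_mono: "outer_capacity C \<Longrightarrow> A \<subseteq> B \<Longrightarrow> C A \<le> C B"
  unfolding outer_capacity_def by blast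

lemma outer_capacity_subadditive:
  fixes F :: "nat \<Rightarrow> 'a::topological_space set"
  shows "outer_capacity C \<Longrightarrow> A \<subseteq> (\<Union>i. F i) \<Longrightarrow> C A \<le> (\<Sum>i. C (F i))"
  unfolding outer_capacity_def by blast

lemma outer_capacity_regular:
  "outer_capacity C \<Longrightarrow> C A = (INF U\<in>{U. A \<subseteq> U \<and> open U}. C U)"
  unfolding outer_capacity_def by blast

lemma outer_capacity_countable_cover:
  assumes "outer_capacity C" "countable G" "A \<subseteq> \<Union>G"
  shows "C A \<le> (\<Sum>\<^sub>\<infinity>R\<in>G. C (A \<inter> R))"
proof -
  define I where "I = to_nat_on G ` G"
  \<comment> \<open>Outside \<open>I\<close>, \<open>from_nat_into\<close> returns a default; the
    empty set costs nothing and keeps each member of \<open>G\<close> counted once.\<close>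
  define F where "F i = (if i \<in> I then A \<inter> from_nat_into G i else {})" for i
  have "A \<subseteq> (\<Union>i. F i)"
  proof
    fix x assume "x \<in> A"
    then obtain R where "R \<in> G" "x \<in> R" using assms(3) by auto
    then have "x \<in> F (to_nat_on G R)"
      using \<open>x \<in> A\<close> assms(2) by (auto simp: F_def I_def)
    then show "x \<in> (\<Union>i. F i)" by blast
  qed
  then have "C A \<le> (\<Sum>i. C (F i))"
    by (rule outer_capacity_subadditive[OF assms(1)])
  also have "\<dots> \<le> (\<Sum>\<^sub>\<infinity>R\<in>G. C (A \<inter> R))"
  proof (rule suminf_le_const[OF summableI])
    fix n
    have inj: "inj_on (from_nat_into G) I"
      using assms(2) by (auto simp: I_def inj_on_def)
    have "(\<Sum>i<n. C (F i)) = (\<Sum>i\<in>{..<n} \<inter> I. C (A \<inter> from_nat_into G i))"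
      using outer_capacity_empty[OF assms(1)]
      by (intro sum.mono_neutral_cong_right) (auto simp: F_def)
    also have "\<dots> = (\<Sum>R\<in>from_nat_into G ` ({..<n} \<inter> I). C (A \<inter> R))"
      by (subst sum.reindex) (auto intro: inj_on_subset[OF inj])
    also have "\<dots> \<le> (\<Sum>\<^sub>\<infinity>R\<in>G. C (A \<inter> R))"
      by (rule sum_le_infsum_ennreal) (auto simp: I_def assms(2))
    finally show "(\<Sum>i<n. C (F i)) \<le> (\<Sum>\<^sub>\<infinity>R\<in>G. C (A \<inter> R))" .
  qed
  finally show ?thesis .
qed

lemma outer_capacity_Un:
  assumes "outer_capacity C"
  shows "C (A \<union> B) \<le> C A + C B"
proof -
  define F where "F i = (if i = (0::nat) then A else if i = 1 then B else {})" for i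
  have "A \<union> B \<subseteq> (\<Union>i. F i)"
  proof -
    have "F 0 = A" "F 1 = B" by (auto simp: F_def)
    then show ?thesis by blast
  qed
  then have "C (A \<union> B) \<le> (\<Sum>i. C (F i))"
    by (rule outer_capacity_subadditive[OF assms])
  also have "\<dots> = (\<Sum>i\<in>{0,1}. C (F i))"
    using outer_capacity_empty[OF assms] by (intro suminf_finite) (auto simp: F_def)
  also have "\<dots> = C A + C B" by (simp add: F_def)
  finally show ?thesis .
qed

subsection \<open>Packed families and the level set decay\<close>

text \<open>Packing with constant 1. It is tested on finite subfamilies so that it passes to unions
  of chains; \<open>packed_infsum_le\<close> recovers the bound for the full sum.\<close>

definition packed :: "('a set \<Rightarrow> ennreal) \<Rightarrow> 'a set set \<Rightarrow> 'a set set \<Rightarrow> bool" where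
  "packed C T S \<longleftrightarrow> (\<forall>Q\<in>T. \<forall>H. finite H \<longrightarrow> H \<subseteq> {R \<in> S. R \<subseteq> Q} \<longrightarrow> sum C H \<le> C Q)"

lemma packed_infsum_le:
  assumes "packed C T S" "Q \<in> T"
  shows "infsum C {R \<in> S. R \<subseteq> Q} \<le> C Q"
  using assms unfolding packed_def by (intro infsum_le_ennreal) blast

text \<open>A finite subset of the union of a chain already lies in one member of the chain, so
  packing survives the union and Zorn's lemma applies.\<close>

lemma maximal_packed_exists:
  obtains S where "S \<subseteq> F" "packed C T S"
    "\<And>S'. S' \<subseteq> F \<Longrightarrow> packed C T S' \<Longrightarrow> S \<subseteq> S' \<Longrightarrow> S' = S"
proof -
  let ?A = "{S. S \<subseteq> F \<and> packed C T S}"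
  have "\<exists>M\<in>?A. \<forall>X\<in>?A. M \<subseteq> X \<longrightarrow> X = M"
  proof (rule subset_Zorn_nonempty)
    have "{} \<in> ?A" by (auto simp: packed_def)
    then show "?A \<noteq> {}" by blast
  next
    fix \<C> assume c: "\<C> \<noteq> {}" "subset.chain ?A \<C>"
    have "packed C T (\<Union>\<C>)" unfolding packed_def
    proof (intro ballI allI impI)
      fix Q H assume H: "Q \<in> T" "finite H" "H \<subseteq> {R \<in> \<Union>\<C>. R \<subseteq> Q}"
      then obtain S where S: "S \<in> \<C>" "H \<subseteq> S"
        using finite_subset_Union_chain[of H \<C> ?A] c by blast
      then have "packed C T S"
        using c by (auto simp: subset.chain_def)
      then show "sum C H \<le> C Q"
        using H S unfolding packed_def by blast
    qed
    then show "\<Union>\<C> \<in> ?A"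
      using c by (auto simp: subset.chain_def)
  qed
  then obtain M where M: "M \<in> ?A" "\<forall>X\<in>?A. M \<subseteq> X \<longrightarrow> X = M" by blast
  have "S' = M" if "S' \<subseteq> F" "packed C T S'" "M \<subseteq> S'" for S'
    using M(2) that by simp
  with M(1) show thesis by (intro that[of M]) auto
qed

section \<open>Trees of cubes and the selection of packed subfamilies\<close>

definition maximal_sets :: "'a set set \<Rightarrow> 'a set set" where
  "maximal_sets F = {X \<in> F. \<forall>Y\<in>F. X \<subseteq> Y \<longrightarrow> Y = X}"

text \<open>The properties of the finite dyadic cubes on which the decay rests.
  \<open>parent\<close> is the form in which doubling enters, and \<open>packing\<close> is the
  packing assumption for indicator functions and disjoint families inside one cube.\<close>

locale packing_tree =
  fixes C :: "'a::topological_space set \<Rightarrow> ennreal" and T :: "'a set set" and D A0 :: real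
  assumes capacity: "outer_capacity C"
    and countable_tree: "countable T"
    and nested: "\<And>X Y. X \<in> T \<Longrightarrow> Y \<in> T \<Longrightarrow> X \<subseteq> Y \<or> Y \<subseteq> X \<or> X \<inter> Y = {}"
    and finite_between: "\<And>R P. R \<in> T \<Longrightarrow> P \<in> T \<Longrightarrow> finite {X \<in> T. R \<subseteq> X \<and> X \<subseteq> P}"
    and parent: "\<And>R P. R \<in> T \<Longrightarrow> P \<in> T \<Longrightarrow> R \<subset> P \<Longrightarrow>
      \<exists>X\<in>T. R \<subset> X \<and> X \<subseteq> P \<and> C X \<le> ennreal D * C R"
    and basis: "\<And>P U x. P \<in> T \<Longrightarrow> open U \<Longrightarrow> x \<in> P \<Longrightarrow> x \<in> U \<Longrightarrow> \<exists>R\<in>T. x \<in> R \<and> R \<subseteq> U \<inter> P"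
    and pos: "\<And>R. R \<in> T \<Longrightarrow> 0 < C R"
    and fin: "\<And>R. R \<in> T \<Longrightarrow> C R < \<infinity>"
    and D_ge: "D \<ge> 1" and A0_ge: "A0 \<ge> 1"
    and packing: "\<And>P S E. P \<in> T \<Longrightarrow> S \<subseteq> T \<Longrightarrow> \<Union>S \<subseteq> P \<Longrightarrow> pairwise disjnt S \<Longrightarrow> packed C T S \<Longrightarrow>
      (\<Sum>\<^sub>\<infinity>R\<in>S. C (E \<inter> R)) \<le> ennreal A0 * C (E \<inter> \<Union>S)"
begin

lemma nonempty: "R \<in> T \<Longrightarrow> R \<noteq> {}"
  using pos outer_capacity_empty[OF capacity] by fastforce

lemma disjoint_maximal_sets:
  assumes "F \<subseteq> T"
  shows "pairwise disjnt (maximal_sets F)"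
proof (rule pairwiseI)
  fix X Y assume XY: "X \<in> maximal_sets F" "Y \<in> maximal_sets F" "X \<noteq> Y"
  then have "X \<in> T" "Y \<in> T" "\<not> X \<subseteq> Y" "\<not> Y \<subseteq> X"
    using assms by (auto simp: maximal_sets_def)
  then show "disjnt X Y"
    using nested by (auto simp: disjnt_def)
qed

text \<open>Only finitely many cubes lie between \<open>R\<close> and \<open>P\<close>, so among the
  members of \<open>F\<close> containing \<open>R\<close> there is a maximal one.\<close>

lemma maximal_sets_cover:
  assumes "F \<subseteq> T" "P \<in> T" "\<Union>F \<subseteq> P" "R \<in> F"
  shows "\<exists>X\<in>maximal_sets F. R \<subseteq> X"
proof -
  let ?B = "{X \<in> F. R \<subseteq> X}"
  have "finite ?B"
    by (rule finite_subset[OF _ finite_between[of R P]]) (use assms in auto)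
  moreover have "R \<in> ?B" using assms by auto
  ultimately obtain X where X: "X \<in> ?B" "\<forall>Y\<in>?B. X \<subseteq> Y \<longrightarrow> Y = X"
    using finite_has_maximal[of ?B] by (metis (no_types, lifting) empty_iff)
  then have "X \<in> maximal_sets F"
    by (auto simp: maximal_sets_def)
  then show ?thesis using X by blast
qed

text \<open>Since \<open>A0\<close> may equal 1, only families packed with constant 1 are usable. A cube \<open>R\<close> left out of
  a maximal packed family need not be dominated by that family when its obstruction \<open>Q\<close> has
  capacity comparable to \<open>C R\<close>. Replacing \<open>F\<close> first by one cube inside each maximal cube of capacity
  at most \<open>2 * C R\<close>, \<open>R \<in> F\<close>, forces \<open>C R < C Q / 2\<close>.\<close>

lemma packed_selection:
  assumes F: "F \<subseteq> T" and P: "P \<in> T" and FP: "\<Union>F \<subseteq> P"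
  obtains S G where "S \<subseteq> F" "packed C T S" "pairwise disjnt S"
    "G \<subseteq> T" "\<Union>G \<subseteq> P" "\<Union>F \<subseteq> \<Union>G" "\<forall>X\<in>G. \<exists>R\<in>F. R \<subseteq> X"
    "infsum C G \<le> 2 * infsum C S"
proof -
  define H where "H = {X \<in> T. X \<subseteq> P \<and> (\<exists>R\<in>F. R \<subseteq> X \<and> C X \<le> 2 * C R)}"
  define M where "M = maximal_sets H"
  have HT: "H \<subseteq> T" and HP: "\<Union>H \<subseteq> P" by (auto simp: H_def)
  have M_disj: "pairwise disjnt M"
    unfolding M_def by (rule disjoint_maximal_sets[OF HT])
  have MH: "M \<subseteq> H" by (auto simp: M_def maximal_sets_def)
  have FH: "F \<subseteq> H"
  proof
    fix R assume "R \<in> F"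
    moreover have "C R \<le> 2 * C R"
      using mult_right_mono[of 1 2 "C R"] by simp
    ultimately show "R \<in> H" using F FP by (auto simp: H_def)
  qed
  have "\<forall>X\<in>M. \<exists>R\<in>F. R \<subseteq> X \<and> C X \<le> 2 * C R"
    using MH by (auto simp: H_def)
  then obtain r where r: "\<And>X. X \<in> M \<Longrightarrow> r X \<in> F \<and> r X \<subseteq> X \<and> C X \<le> 2 * C (r X)"
    by metis
  obtain S where S: "S \<subseteq> r ` M" "packed C T S"
    and S_max: "\<And>S'. S' \<subseteq> r ` M \<Longrightarrow> packed C T S' \<Longrightarrow> S \<subseteq> S' \<Longrightarrow> S' = S"
    by (rule maximal_packed_exists[of "r ` M" C T]) (rule that)
  have SF: "S \<subseteq> F" using S(1) r by blast
  have in_M: "X = Y" if "X \<in> M" "Y \<in> M" "X \<inter> Y \<noteq> {}" for X Y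
    using M_disj that by (auto simp: pairwise_def disjnt_def)
  have S_disj: "pairwise disjnt S"
    unfolding pairwise_def disjnt_def
  proof (intro ballI impI)
    fix R R' assume "R \<in> S" "R' \<in> S" "R \<noteq> R'"
    then obtain X Y where "X \<in> M" "Y \<in> M" "R = r X" "R' = r Y" using S(1) by blast
    then show "R \<inter> R' = {}" using in_M[of X Y] r[of X] r[of Y] \<open>R \<noteq> R'\<close> by blast
  qed
  \<comment> \<open>Cubes dominated by the selected cubes inside them. The maximal ones will form
    \<open>G\<close>: they are disjoint, so their bounds add up without overlap.\<close>
  define B where "B = {X \<in> T. X \<subseteq> P \<and> (\<exists>R\<in>F. R \<subseteq> X) \<and> C X \<le> 2 * infsum C {R \<in> S. R \<subseteq> X}}"
  have dominated: "\<exists>Q\<in>B. X \<subseteq> Q" if X: "X \<in> M" for X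
  proof (cases "r X \<in> S")
    case True
    have "C X \<le> 2 * C (r X)" using r X by blast
    also have "C (r X) = sum C {r X}" by simp
    also have "sum C {r X} \<le> infsum C {R \<in> S. R \<subseteq> X}"
      by (rule sum_le_infsum_ennreal) (use True r X in auto)
    finally have "C X \<le> 2 * infsum C {R \<in> S. R \<subseteq> X}"
      by (simp add: mult_left_mono)
    then have "X \<in> B"
      using X MH r[OF X] by (auto simp: B_def H_def)
    then show ?thesis by blast
  next
    case False
    have rX: "r X \<in> F" "r X \<subseteq> X" "r X \<in> T" "r X \<noteq> {}"
      using r[OF X] F nonempty by auto
    have XT: "X \<in> T" "X \<subseteq> P" using X MH by (auto simp: H_def)
    \<comment> \<open>\<open>S\<close> is maximal, so adding \<open>r X\<close> breaks the packing
      condition at some cube \<open>Q0\<close>, and the violating finite family must contain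
      \<open>r X\<close>.\<close>
    have "\<not> packed C T (insert (r X) S)"
      using S_max[of "insert (r X) S"] S(1) X False by blast
    then obtain Q0 K where Q0: "Q0 \<in> T" "finite K" "K \<subseteq> {R \<in> insert (r X) S. R \<subseteq> Q0}" "C Q0 < sum C K"
      unfolding packed_def by (auto simp: not_le)
    have rK: "r X \<in> K"
    proof (rule ccontr)
      assume "r X \<notin> K"
      then have "K \<subseteq> {R \<in> S. R \<subseteq> Q0}" using Q0 by auto
      then have "sum C K \<le> C Q0" using S(2) Q0 unfolding packed_def by blast
      then show False using Q0 by auto
    qed
    \<comment> \<open>The obstruction is brought inside \<open>P\<close>. If \<open>Q0\<close> is
      not contained in \<open>P\<close>, then it contains \<open>P\<close>, because both contain the
      nonempty \<open>r X\<close>; passing to \<open>P\<close> loses no cube of \<open>K\<close> and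
      does not raise the capacity.\<close>
    define Q where "Q = (if Q0 \<subseteq> P then Q0 else P)"
    have rQ0: "r X \<subseteq> Q0" using rK Q0 by auto
    have QQ0: "Q \<subseteq> Q0"
    proof (cases "Q0 \<subseteq> P")
      case False
      have "Q0 \<inter> P \<noteq> {}" using rQ0 rX XT by blast
      then show ?thesis using nested[of Q0 P] Q0 P False by (auto simp: Q_def)
    qed (auto simp: Q_def)
    have Q: "Q \<in> T" "Q \<subseteq> P" using Q0 P by (auto simp: Q_def)
    have KQ: "K \<subseteq> {R \<in> insert (r X) S. R \<subseteq> Q}"
    proof -
      have *: "R \<subseteq> P" if "R \<in> insert (r X) S" for R using that SF FP rX XT by auto
      show ?thesis
      proof
        fix R assume "R \<in> K"
        then have "R \<in> insert (r X) S" "R \<subseteq> Q0" using Q0(3) by auto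
        then show "R \<in> {R \<in> insert (r X) S. R \<subseteq> Q}" using * by (auto simp: Q_def)
      qed
    qed
    have CQ: "C Q < sum C K"
      using outer_capacity_mono[OF capacity QQ0] Q0(4) by auto
    have split: "sum C K = C (r X) + sum C (K - {r X})"
      using Q0(2) rK by (simp add: sum.remove)
    have KS: "K - {r X} \<subseteq> {R \<in> S. R \<subseteq> Q}" using KQ by auto
    \<comment> \<open>Otherwise \<open>Q\<close> lies in \<open>X\<close>. By disjointness of
      \<open>M\<close> the only cube of \<open>K\<close> inside \<open>X\<close> is
      \<open>r X\<close>, and a single cube inside \<open>Q\<close> cannot have capacity above
      \<open>C Q\<close>.\<close>
    have XQ: "X \<subset> Q"
    proof (rule ccontr)
      assume "\<not> X \<subset> Q"
      moreover have "X \<inter> Q \<noteq> {}" using rX rK KQ by blast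
      ultimately have QX: "Q \<subseteq> X" using nested[OF XT(1) Q(1)] by blast
      have "K - {r X} = {}"
      proof -
        have "R = r X" if "R \<in> K" "R \<noteq> r X" for R
        proof -
          have "R \<in> S" "R \<subseteq> X" using that KQ QX by auto
          then obtain Y where "Y \<in> M" "R = r Y" using S(1) by auto
          then show ?thesis
            using in_M[of X Y] X r[of Y] \<open>R \<subseteq> X\<close> F nonempty by blast
        qed
        then show ?thesis by blast
      qed
      then have "sum C K = C (r X)" unfolding split by (simp only: sum.empty add_0_right)
      also have "\<dots> \<le> C Q"
        using rK KQ by (intro outer_capacity_mono[OF capacity]) auto
      finally show False using CQ by auto
    qed
    \<comment> \<open>\<open>X\<close> is maximal in \<open>H\<close>. A strictly larger cube
      therefore has more than twice the capacity of each cube of \<open>F\<close> inside it, in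
      particular of \<open>r X\<close>.\<close>
    have "Q \<notin> H" using XQ X unfolding M_def maximal_sets_def by blast
    then have half: "2 * C (r X) < C Q"
      using Q rX XQ by (auto simp: H_def not_le)
    have le: "sum C (K - {r X}) \<le> infsum C {R \<in> S. R \<subseteq> Q}"
      using KS Q0(2) by (intro sum_le_infsum_ennreal) auto
    have "C Q \<le> C (r X) + sum C (K - {r X})"
      using CQ unfolding split by simp
    also have "\<dots> \<le> C (r X) + infsum C {R \<in> S. R \<subseteq> Q}"
      by (rule add_left_mono[OF le])
    finally have "C Q \<le> 2 * infsum C {R \<in> S. R \<subseteq> Q}"
      by (rule le_double_of_half_le) (use half fin[OF Q(1)] in auto)
    moreover have "r X \<subseteq> Q" using rX(2) XQ by blast
    ultimately have "Q \<in> B" using Q rX(1) unfolding B_def by blast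
    then show ?thesis using XQ by blast
  qed
  define G where "G = maximal_sets B"
  have BT: "B \<subseteq> T" and BP: "\<Union>B \<subseteq> P" by (auto simp: B_def)
  have GB: "G \<subseteq> B" by (auto simp: G_def maximal_sets_def)
  have G_disj: "pairwise disjnt G"
    unfolding G_def by (rule disjoint_maximal_sets[OF BT])
  have cover: "\<Union>F \<subseteq> \<Union>G"
  proof
    fix x assume "x \<in> \<Union>F"
    then obtain R where R: "R \<in> F" "x \<in> R" by blast
    obtain X where X: "X \<in> M" "R \<subseteq> X"
      using maximal_sets_cover[OF HT P HP, of R] R FH unfolding M_def by blast
    obtain Q where Q: "Q \<in> B" "X \<subseteq> Q" using dominated X by blast
    obtain Y where "Y \<in> G" "Q \<subseteq> Y"
      using maximal_sets_cover[OF BT P BP Q(1)] unfolding G_def by blast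
    then show "x \<in> \<Union>G" using R X Q by blast
  qed
  have "infsum C G \<le> 2 * infsum C S"
  proof (rule infsum_le_ennreal)
    fix K assume K: "finite K" "K \<subseteq> G"
    have "sum C K \<le> (\<Sum>X\<in>K. 2 * infsum C {R \<in> S. R \<subseteq> X})"
      using K GB by (intro sum_mono) (auto simp: B_def)
    also have "\<dots> = 2 * (\<Sum>X\<in>K. infsum C {R \<in> S. R \<subseteq> X})"
      by (simp add: sum_distrib_left)
    also have "\<dots> \<le> 2 * infsum C S"
      using K G_disj SF F nonempty
      by (intro mult_left_mono sum_infsum_disjoint_le) (auto intro: pairwise_subset)
    finally show "sum C K \<le> 2 * infsum C S" .
  qed
  moreover have "\<forall>X\<in>G. \<exists>R\<in>F. R \<subseteq> X" using GB by (auto simp: B_def)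
  ultimately show thesis
    by (intro that[OF SF S(2) S_disj subset_trans[OF GB BT] subset_trans[OF Union_mono[OF GB] BP] cover])
qed

text \<open>For open \<open>U\<close> containing \<open>E\<close>, the cubes in \<open>U\<close>
  that meet \<open>E\<close> cover \<open>E\<close>. Selection, packing and the density bound give
  \<open>C E\<close> at most \<open>2 * A0 * d * C U\<close>, hence at most half of
  \<open>C U\<close>. Outer regularity turns this into \<open>C E\<close> being at most half of
  itself, and \<open>C E\<close> is finite.\<close>

lemma density_zero:
  assumes P: "P \<in> T" and EP: "E \<subseteq> P" and d: "d \<ge> 0" "4 * A0 * d \<le> 1"
    and small: "\<And>R. R \<in> T \<Longrightarrow> R \<subseteq> P \<Longrightarrow> E \<inter> R \<noteq> {} \<Longrightarrow> C (E \<inter> R) \<le> ennreal d * C R"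
  shows "C E = 0"
proof -
  have CE: "C E < \<infinity>"
    using outer_capacity_mono[OF capacity EP] fin[OF P] by auto
  have "C E \<le> ennreal (1/2) * C U" if U: "E \<subseteq> U" "open U" for U
  proof -
    define F where "F = {R \<in> T. R \<subseteq> U \<inter> P \<and> E \<inter> R \<noteq> {}}"
    have F: "F \<subseteq> T" "\<Union>F \<subseteq> P" by (auto simp: F_def)
    have "E \<subseteq> \<Union>F"
    proof
      fix x assume "x \<in> E"
      then obtain R where "R \<in> T" "x \<in> R" "R \<subseteq> U \<inter> P"
        using basis[OF P U(2), of x] U EP by blast
      then show "x \<in> \<Union>F" using \<open>x \<in> E\<close> by (auto simp: F_def)
    qed
    obtain S G where S: "S \<subseteq> F" "packed C T S" "pairwise disjnt S"
      and G: "G \<subseteq> T" "\<Union>G \<subseteq> P" "\<Union>F \<subseteq> \<Union>G" "\<forall>X\<in>G. \<exists>R\<in>F. R \<subseteq> X"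
        "infsum C G \<le> 2 * infsum C S"
      by (rule packed_selection[OF F(1) P F(2)])
    have S': "S \<subseteq> T" "\<Union>S \<subseteq> P" "\<Union>S \<subseteq> U" using S(1) by (auto simp: F_def)
    have "C E \<le> (\<Sum>\<^sub>\<infinity>R\<in>G. C (E \<inter> R))"
      using G \<open>E \<subseteq> \<Union>F\<close> countable_subset[OF G(1) countable_tree]
      by (intro outer_capacity_countable_cover[OF capacity]) auto
    also have "\<dots> \<le> (\<Sum>\<^sub>\<infinity>R\<in>G. ennreal d * C R)"
    proof (intro infsum_mono nonneg_summable_on_complete)
      fix R assume R: "R \<in> G"
      \<comment> \<open>The cube \<open>R\<close> may leave \<open>U\<close>, but it contains a cube
        of \<open>F\<close> and so meets \<open>E\<close>; thus \<open>small\<close> applies to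
        it.\<close>
      then have "E \<inter> R \<noteq> {}" using G(4) unfolding F_def by blast
      then show "C (E \<inter> R) \<le> ennreal d * C R"
        using small R G by blast
    qed auto
    also have "\<dots> \<le> ennreal d * infsum C G" by (rule infsum_cmult_le_ennreal)
    also have "\<dots> \<le> ennreal d * (2 * infsum C S)"
      using G(5) by (rule mult_left_mono) simp
    \<comment> \<open>Packing is used with the test set \<open>UNIV\<close>. Only the selected cubes
      are compared with \<open>U\<close>, and these do lie in \<open>U\<close>.\<close>
    also have "infsum C S = (\<Sum>\<^sub>\<infinity>R\<in>S. C (UNIV \<inter> R))" by simp
    also have "(\<Sum>\<^sub>\<infinity>R\<in>S. C (UNIV \<inter> R)) \<le> ennreal A0 * C (UNIV \<inter> \<Union>S)"
      by (rule packing[OF P S'(1,2) S(3,2)])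
    also have "C (UNIV \<inter> \<Union>S) \<le> C U"
      using S' by (intro outer_capacity_mono[OF capacity]) auto
    finally have "C E \<le> ennreal d * (2 * (ennreal A0 * C U))"
      by (simp add: mult_left_mono)
    also have "\<dots> = ennreal (2 * A0 * d) * C U"
      using d A0_ge by (simp add: ennreal_mult ac_simps)
    also have "\<dots> \<le> ennreal (1/2) * C U"
      using d by (intro mult_right_mono ennreal_leI) auto
    finally show ?thesis .
  qed
  then have "2 * C E \<le> C U" if "E \<subseteq> U" "open U" for U
  proof -
    have "2 * C E \<le> 2 * (ennreal (1/2) * C U)"
      using that \<open>\<And>U. E \<subseteq> U \<Longrightarrow> open U \<Longrightarrow> C E \<le> ennreal (1/2) * C U\<close> by (intro mult_left_mono) auto
    also have "2 * (ennreal (1/2) * C U) = ennreal (2 * (1/2)) * C U"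
      by (subst ennreal_mult) (auto simp: ac_simps)
    finally show ?thesis by simp
  qed
  then have "2 * C E \<le> C E"
    by (subst (2) outer_capacity_regular[OF capacity]) (auto intro!: INF_greatest)
  then show ?thesis
    using CE by (cases "C E") (auto simp: ennreal_mult[symmetric] simp flip: ennreal_numeral)
qed

text \<open>The weak-type consequence of a mean deviation at most \<open>K\<close>. The decay
  argument sees \<open>f\<close> only through these level sets, so it needs subadditivity of the
  capacity but none of the Choquet integral.\<close>

definition osc_bound :: "('a \<Rightarrow> real) \<Rightarrow> real \<Rightarrow> 'a set \<Rightarrow> real \<Rightarrow> bool" where
  "osc_bound f K R c \<longleftrightarrow> (\<forall>r>0. ennreal r * C {x \<in> R. \<bar>f x - c\<bar> > r} \<le> ennreal K * C R)"

lemma osc_boundD: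
  assumes "osc_bound f K R c" "r > 0" "K \<ge> 0"
  shows "C {x \<in> R. \<bar>f x - c\<bar> > r} \<le> ennreal (K / r) * C R"
proof -
  have "C {x \<in> R. \<bar>f x - c\<bar> > r} = ennreal (1/r) * (ennreal r * C {x \<in> R. \<bar>f x - c\<bar> > r})"
    using assms by (simp add: mult.assoc[symmetric] ennreal_mult[symmetric])
  also have "\<dots> \<le> ennreal (1/r) * (ennreal K * C R)"
    using assms unfolding osc_bound_def by (intro mult_left_mono) auto
  also have "\<dots> = ennreal (K / r) * C R"
    using assms by (simp add: mult.assoc[symmetric] ennreal_mult[symmetric])
  finally show ?thesis .
qed

text \<open>The stopping cubes are the maximal cubes in which \<open>E\<close> has density above
  \<open>d\<close>; \<open>G\<close> is the cover of them given by \<open>packed_selection\<close>.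
  The factor \<open>D\<close> is the price of one step to a larger cube, the factor
  \<open>2 * A0 / d\<close> that of selection, packing and the stopping condition together.\<close>

lemma stopping_family:
  assumes P: "P \<in> T" and EP: "E \<subseteq> P" and d: "d > 0" "4 * A0 * d \<le> 1"
    and CE: "C E \<le> ennreal d * C P"
  obtains G where "G \<subseteq> T" "\<Union>G \<subseteq> P" "C (E - \<Union>G) = 0"
    "\<And>R. R \<in> G \<Longrightarrow> C (E \<inter> R) \<le> ennreal (d * D) * C R"
    "infsum C G \<le> ennreal (2 * A0 / d) * C E"
proof -
  define B where "B = {R \<in> T. R \<subseteq> P \<and> C (E \<inter> R) > ennreal d * C R}"
  define F where "F = maximal_sets B"
  have B: "B \<subseteq> T" "\<Union>B \<subseteq> P" by (auto simp: B_def)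
  have FB: "F \<subseteq> B" by (auto simp: F_def maximal_sets_def)
  have F: "F \<subseteq> T" "\<Union>F \<subseteq> P" using FB B by auto
  obtain S G where S: "S \<subseteq> F" "packed C T S" "pairwise disjnt S"
    and G: "G \<subseteq> T" "\<Union>G \<subseteq> P" "\<Union>F \<subseteq> \<Union>G" "\<forall>X\<in>G. \<exists>R\<in>F. R \<subseteq> X"
      "infsum C G \<le> 2 * infsum C S"
    by (rule packed_selection[OF F(1) P F(2)])
  have S': "S \<subseteq> T" "\<Union>S \<subseteq> P" using S(1) F by auto
  have zero: "C (E - \<Union>G) = 0"
  proof (rule density_zero[OF P _ _ d(2)])
    fix R assume R: "R \<in> T" "R \<subseteq> P" "(E - \<Union>G) \<inter> R \<noteq> {}"
    \<comment> \<open>Every cube of density above \<open>d\<close> lies in a stopping cube, hence in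
      \<open>\<Union>G\<close>. A cube meeting the remainder thus has density at most
      \<open>d\<close>, as \<open>density_zero\<close> requires.\<close>
    have "R \<notin> B"
    proof
      assume "R \<in> B"
      then obtain X where "X \<in> F" "R \<subseteq> X"
        using maximal_sets_cover[OF B(1) P B(2)] unfolding F_def by blast
      then have "R \<subseteq> \<Union>G" using G(3) by blast
      then show False using R by blast
    qed
    then have "C (E \<inter> R) \<le> ennreal d * C R" using R by (auto simp: B_def not_less)
    moreover have "C ((E - \<Union>G) \<inter> R) \<le> C (E \<inter> R)"
      by (rule outer_capacity_mono[OF capacity]) blast
    ultimately show "C ((E - \<Union>G) \<inter> R) \<le> ennreal d * C R"
      by (rule order.trans[rotated])
  qed (use EP d in auto)
  have small: "C (E \<inter> X) \<le> ennreal (d * D) * C X" if X: "X \<in> G" for X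
  proof -
    have XT: "X \<in> T" "X \<subseteq> P" using X G by auto
    \<comment> \<open>A cube strictly larger than a stopping cube was not stopped. Each
      \<open>X\<close> in \<open>G\<close> contains a stopping cube, so this applies to any cube
      strictly above \<open>X\<close> within \<open>P\<close>; for \<open>X = P\<close> the
      hypothesis \<open>CE\<close> takes over.\<close>
    have nonstop: "C (E \<inter> Y) \<le> ennreal d * C Y" if Y: "Y \<in> T" "Y \<subseteq> P" "R \<in> F" "R \<subset> Y" for R Y
    proof (rule ccontr)
      assume "\<not> ?thesis"
      then have "Y \<in> B" using Y by (auto simp: B_def)
      then show False using Y(3,4) by (auto simp: F_def maximal_sets_def)
    qed
    obtain R where R: "R \<in> F" "R \<subseteq> X" using bspec[OF G(4) X] by (elim bexE)
    show ?thesis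
    proof (cases "X = P")
      case True
      have "C (E \<inter> P) \<le> ennreal d * C P"
        using CE EP by (simp add: Int_absorb2)
      also have "\<dots> \<le> ennreal (d * D) * C P"
        using d D_ge by (intro mult_right_mono ennreal_leI) auto
      finally show ?thesis using True by simp
    next
      case False
      then obtain Y where Y: "Y \<in> T" "X \<subset> Y" "Y \<subseteq> P" "C Y \<le> ennreal D * C X"
        using parent[OF XT(1) P] XT by blast
      have "C (E \<inter> X) \<le> C (E \<inter> Y)"
        using Y by (intro outer_capacity_mono[OF capacity]) auto
      also have "\<dots> \<le> ennreal d * C Y"
        using nonstop[of Y R] Y R by blast
      also have "\<dots> \<le> ennreal d * (ennreal D * C X)"
        using Y(4) by (rule mult_left_mono) simp
      also have "\<dots> = ennreal (d * D) * C X"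
        using d D_ge by (simp add: ennreal_mult mult.assoc)
      finally show ?thesis .
    qed
  qed
  \<comment> \<open>On selected cubes the stopping condition trades \<open>C R\<close> for
    \<open>C (E \<inter> R)\<close>, and the sum of the latter is what packing with test set
    \<open>E\<close> controls.\<close>
  have "infsum C S \<le> (\<Sum>\<^sub>\<infinity>R\<in>S. ennreal (1/d) * C (E \<inter> R))"
  proof (intro infsum_mono nonneg_summable_on_complete)
    fix R assume "R \<in> S"
    then have "ennreal d * C R \<le> C (E \<inter> R)" using S(1) FB by (auto simp: B_def)
    then have "ennreal (1/d) * (ennreal d * C R) \<le> ennreal (1/d) * C (E \<inter> R)"
      by (rule mult_left_mono) simp
    then show "C R \<le> ennreal (1/d) * C (E \<inter> R)"
      using d by (simp add: mult.assoc[symmetric] ennreal_mult[symmetric])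
  qed auto
  also have "\<dots> \<le> ennreal (1/d) * (\<Sum>\<^sub>\<infinity>R\<in>S. C (E \<inter> R))"
    by (rule infsum_cmult_le_ennreal)
  also have "(\<Sum>\<^sub>\<infinity>R\<in>S. C (E \<inter> R)) \<le> ennreal A0 * C (E \<inter> \<Union>S)"
    by (rule packing[OF P S' S(3,2)])
  also have "C (E \<inter> \<Union>S) \<le> C E"
    by (intro outer_capacity_mono[OF capacity]) auto
  finally have "infsum C S \<le> ennreal (1/d) * (ennreal A0 * C E)"
    by (simp add: mult_left_mono)
  then have "infsum C G \<le> 2 * (ennreal (1/d) * (ennreal A0 * C E))"
    using G(5) by (meson mult_left_mono order_trans zero_le)
  also have "\<dots> = ennreal (2 * A0 / d) * C E"
  proof -
    have "ennreal (1/d) * ennreal A0 = ennreal (A0 / d)"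
      using d A0_ge by (subst ennreal_mult[symmetric]) auto
    moreover have "ennreal 2 * ennreal (A0 / d) = ennreal (2 * A0 / d)"
      using d A0_ge by (subst ennreal_mult[symmetric]) auto
    ultimately have "ennreal (2 * A0 / d) = 2 * (ennreal (1/d) * ennreal A0)" by simp
    then show ?thesis by (simp only: mult.assoc)
  qed
  finally have "infsum C G \<le> ennreal (2 * A0 / d) * C E" .
  with that G(1,2) zero small show thesis by blast
qed

text \<open>If the centres were farther apart, each point of \<open>R\<close> would have its value
  farther than \<open>s\<close> from \<open>c\<close> or farther than \<open>2 * K\<close> from
  \<open>c'\<close>. These parts have at most a quarter and a half of the capacity of
  \<open>R\<close>, which is positive and finite.\<close>

lemma osc_centre_close:
  assumes R: "R \<in> T" and "K > 0" "s > 0"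
    and E: "C ({x. \<bar>f x - c\<bar> > s} \<inter> R) \<le> ennreal (1/4) * C R"
    and osc: "osc_bound f K R c'"
  shows "\<bar>c' - c\<bar> \<le> s + 2 * K"
proof (rule ccontr)
  assume far: "\<not> ?thesis"
  have "R \<subseteq> ({x. \<bar>f x - c\<bar> > s} \<inter> R) \<union> {x \<in> R. \<bar>f x - c'\<bar> > 2 * K}"
    using far by auto
  then have "C R \<le> C (({x. \<bar>f x - c\<bar> > s} \<inter> R) \<union> {x \<in> R. \<bar>f x - c'\<bar> > 2 * K})"
    by (rule outer_capacity_mono[OF capacity])
  also have "\<dots> \<le> C ({x. \<bar>f x - c\<bar> > s} \<inter> R) + C {x \<in> R. \<bar>f x - c'\<bar> > 2 * K}"
    by (rule outer_capacity_Un[OF capacity])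
  also have "\<dots> \<le> ennreal (1/4) * C R + ennreal (1/2) * C R"
  proof (rule add_mono[OF E])
    show "C {x \<in> R. \<bar>f x - c'\<bar> > 2 * K} \<le> ennreal (1/2) * C R"
      using osc_boundD[OF osc, of "2 * K"] assms by simp
  qed
  also have "\<dots> = ennreal (3/4) * C R"
    by (subst distrib_right[symmetric], subst ennreal_plus[symmetric]) auto
  finally show False
    using pos[OF R] fin[OF R] by (cases "C R") (auto simp: ennreal_mult[symmetric])
qed

text \<open>One step of the induction lowers the height by \<open>b = s + 2 * K\<close>: on each
  cube of the stopping cover at level \<open>s\<close> the new centre is within \<open>b\<close> of
  \<open>c\<close>, so the induction hypothesis applies there at height \<open>t - b\<close>. The
  cover carries at most half of \<open>C P\<close>.\<close>

lemma level_set_decay: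
  assumes K: "K > 0" and b: "b = (16 * A0\<^sup>2 * D + 2) * K"
    and ex: "\<And>R. R \<in> T \<Longrightarrow> R \<subseteq> P0 \<Longrightarrow> \<exists>c. osc_bound f K R c"
  shows "P \<in> T \<Longrightarrow> P \<subseteq> P0 \<Longrightarrow> osc_bound f K P c \<Longrightarrow> t \<ge> real n * b \<Longrightarrow>
    C {x \<in> P. \<bar>f x - c\<bar> > t} \<le> ennreal ((1/2) ^ n) * C P"
proof (induction n arbitrary: P c t)
  case 0
  then show ?case by (auto intro: outer_capacity_mono[OF capacity])
next
  case (Suc n)
  \<comment> \<open>The density \<open>d\<close> is chosen for \<open>4 * A0 * d \<le> 1\<close> in
    \<open>stopping_family\<close> and \<open>d * D \<le> 1/4\<close> in
    \<open>osc_centre_close\<close>. Then \<open>s\<close> is chosen for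
    \<open>K / s = d / (4 * A0)\<close>, so that the factor \<open>2 * A0 / d\<close> of
    \<open>stopping_family\<close> leaves exactly \<open>1/2\<close>.\<close>
  define s where "s = 16 * A0\<^sup>2 * D * K"
  define d where "d = 1 / (4 * A0 * D)"
  define E where "E = {x \<in> P. \<bar>f x - c\<bar> > s}"
  have pos': "s > 0" "d > 0" "A0 > 0" "D > 0" using K A0_ge D_ge by (auto simp: s_def d_def)
  have b': "b = s + 2 * K" by (simp add: b s_def algebra_simps)
  have d4: "4 * A0 * d \<le> 1" "d * D \<le> 1/4"
    using A0_ge D_ge by (auto simp: d_def field_simps)
  have Ks: "K / s = d / (4 * A0)"
    using pos' K by (simp add: s_def d_def field_simps power2_eq_square)
  have CE: "C E \<le> ennreal (d / (4 * A0)) * C P"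
    using osc_boundD[OF Suc.prems(3) pos'(1)] K by (simp add: E_def Ks)
  also have "\<dots> \<le> ennreal d * C P"
    using pos' A0_ge by (intro mult_right_mono ennreal_leI) (auto simp: field_simps)
  finally have CE': "C E \<le> ennreal d * C P" .
  have "E \<subseteq> P" by (auto simp: E_def)
  then obtain G where G: "G \<subseteq> T" "\<Union>G \<subseteq> P" "C (E - \<Union>G) = 0"
    "\<And>R. R \<in> G \<Longrightarrow> C (E \<inter> R) \<le> ennreal (d * D) * C R" "infsum C G \<le> ennreal (2 * A0 / d) * C E"
    using stopping_family[OF Suc.prems(1) _ pos'(2) d4(1) CE'] by metis
  let ?L = "{x \<in> P. \<bar>f x - c\<bar> > t}"
  have "b > 0" using b' pos' K by simp
  have tb: "t \<ge> real n * b + b" using Suc.prems(4) by (simp add: algebra_simps)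
  have "t \<ge> s" 
  proof -
    have "real n * b \<ge> 0" using \<open>b > 0\<close> by simp
    then show ?thesis using tb b' K by simp
  qed
  have LE: "?L \<subseteq> E" using \<open>t \<ge> s\<close> by (auto simp: E_def)
  have piece: "C (?L \<inter> R) \<le> ennreal ((1/2) ^ n) * C R" if R: "R \<in> G" for R
  proof -
    have RT: "R \<in> T" "R \<subseteq> P" "R \<subseteq> P0" using R G Suc.prems by auto
    obtain c' where c': "osc_bound f K R c'" using ex RT by blast
    have "E \<inter> R = {x. \<bar>f x - c\<bar> > s} \<inter> R" using RT by (auto simp: E_def)
    then have "C ({x. \<bar>f x - c\<bar> > s} \<inter> R) \<le> ennreal (d * D) * C R" using G(4)[OF R] by simp
    also have "\<dots> \<le> ennreal (1/4) * C R"
      using d4 by (intro mult_right_mono ennreal_leI) auto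
    finally have "\<bar>c' - c\<bar> \<le> b"
      unfolding b' by (rule osc_centre_close[OF RT(1) K pos'(1) _ c'])
    then have "?L \<inter> R \<subseteq> {x \<in> R. \<bar>f x - c'\<bar> > t - b}" by auto
    then have "C (?L \<inter> R) \<le> C {x \<in> R. \<bar>f x - c'\<bar> > t - b}"
      by (rule outer_capacity_mono[OF capacity])
    also have "\<dots> \<le> ennreal ((1/2) ^ n) * C R"
      by (rule Suc.IH[OF RT(1,3) c']) (use tb in simp)
    finally show ?thesis .
  qed
  have "C ?L \<le> C ((E - \<Union>G) \<union> (?L \<inter> \<Union>G))"
    using LE by (intro outer_capacity_mono[OF capacity]) auto
  also have "\<dots> \<le> C (E - \<Union>G) + C (?L \<inter> \<Union>G)"
    by (rule outer_capacity_Un[OF capacity])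
  also have "\<dots> = C (?L \<inter> \<Union>G)" using G(3) by simp
  also have "\<dots> \<le> (\<Sum>\<^sub>\<infinity>R\<in>G. C ((?L \<inter> \<Union>G) \<inter> R))"
    using countable_subset[OF G(1) countable_tree]
    by (intro outer_capacity_countable_cover[OF capacity]) auto
  also have "\<dots> \<le> (\<Sum>\<^sub>\<infinity>R\<in>G. ennreal ((1/2) ^ n) * C R)"
  proof (intro infsum_mono nonneg_summable_on_complete)
    fix R assume R: "R \<in> G"
    then have "(?L \<inter> \<Union>G) \<inter> R = ?L \<inter> R" by blast
    then show "C ((?L \<inter> \<Union>G) \<inter> R) \<le> ennreal ((1/2) ^ n) * C R" using piece[OF R] by simp
  qed auto
  also have "\<dots> \<le> ennreal ((1/2) ^ n) * infsum C G" by (rule infsum_cmult_le_ennreal)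
  also have "infsum C G \<le> ennreal (2 * A0 / d) * (ennreal (d / (4 * A0)) * C P)"
    using G(5) CE by (meson mult_left_mono order_trans zero_le)
  also have "\<dots> = ennreal (1/2) * C P"
  proof -
    have "ennreal (2 * A0 / d) * ennreal (d / (4 * A0)) = ennreal (1/2)"
      using pos' by (subst ennreal_mult[symmetric]) (auto simp: field_simps)
    then show ?thesis by (simp add: mult.assoc[symmetric])
  qed
  also have "ennreal ((1/2) ^ n) * (ennreal (1/2) * C P) = ennreal ((1/2) ^ Suc n) * C P"
  proof -
    have "ennreal ((1/2) ^ Suc n) = ennreal ((1/2) ^ n) * ennreal (1/2)"
      by (subst ennreal_mult[symmetric]) auto
    then show ?thesis by (simp only: mult.assoc)
  qed
  finally show ?case by (simp add: mult_left_mono)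
qed

text \<open>The discrete decay is used with \<open>n\<close> the integer part of
  \<open>t / b\<close>. Rounding down costs less than one halving, which is the factor 2 in
  front.\<close>

lemma john_nirenberg:
  assumes K: "K > 0" and "t > 0"
    and ex: "\<And>R. R \<in> T \<Longrightarrow> R \<subseteq> P \<Longrightarrow> \<exists>c. osc_bound f K R c"
    and P: "P \<in> T" and c: "osc_bound f K P c"
  shows "C {x \<in> P. \<bar>f x - c\<bar> > t} \<le>
    ennreal 2 * C P * ennreal (exp (- (ln 2 / (16 * A0\<^sup>2 * D + 2)) * t / K))"
proof -
  define b where "b = (16 * A0\<^sup>2 * D + 2) * K"
  define n where "n = nat \<lfloor>t / b\<rfloor>"
  have "16 * A0\<^sup>2 * D + 2 > 0" using A0_ge D_ge by (intro add_nonneg_pos) auto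
  then have "b > 0" using K by (simp add: b_def)
  have n: "real n \<le> t / b" "t / b \<le> real n + 1"
    using \<open>b > 0\<close> \<open>t > 0\<close> unfolding n_def by (auto simp: le_floor_iff)
  have "C {x \<in> P. \<bar>f x - c\<bar> > t} \<le> ennreal ((1/2) ^ n) * C P"
    by (rule level_set_decay[OF K b_def ex P order_refl c])
      (use n \<open>b > 0\<close> in \<open>auto simp: field_simps\<close>)
  also have "(1/2) ^ n \<le> 2 * exp (- (ln 2) * (t / b))"
  proof -
    have "(1/2::real) ^ n = 2 * exp (- (ln 2) * (real n + 1))"
    proof -
      have "exp (- (ln 2) * (real n + 1)) = exp (- ln 2) ^ n * exp (- ln (2::real))"
        by (simp add: exp_of_nat_mult[symmetric] exp_add[symmetric] algebra_simps)
      then show ?thesis by (simp add: exp_minus power_divide inverse_eq_divide)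
    qed
    also have "\<dots> \<le> 2 * exp (- (ln 2) * (t / b))"
      using mult_left_mono[OF n(2), of "ln 2"] by simp
    finally show ?thesis .
  qed
  then have "ennreal ((1/2) ^ n) * C P \<le> ennreal (2 * exp (- (ln 2) * (t / b))) * C P"
    by (intro mult_right_mono ennreal_leI) auto
  also have "\<dots> = ennreal 2 * C P * ennreal (exp (- (ln 2 / (16 * A0\<^sup>2 * D + 2)) * t / K))"
    by (subst ennreal_mult) (auto simp: b_def ac_simps)
  finally show ?thesis .
qed

end

subsection \<open>Dyadic cubes\<close>

text \<open>Integer coordinates of the cube of side \<open>2 powi k * l\<close> containing
  \<open>y\<close>. Cubes become fibres of this map, and nesting becomes integer division by
  2.\<close>

definition cell_index :: "real ^ 'n \<Rightarrow> real \<Rightarrow> int \<Rightarrow> real ^ 'n \<Rightarrow> int ^ 'n" where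
  "cell_index xQ l k y = (\<chi> i. \<lfloor>(y $ i - xQ $ i) / (2 powi k * l)\<rfloor>)"

definition cell :: "real ^ 'n \<Rightarrow> real \<Rightarrow> int \<Rightarrow> real ^ 'n \<Rightarrow> (real ^ 'n) set" where
  "cell xQ l k x = {y. cell_index xQ l k y = cell_index xQ l k x}"

lemma mem_cell_self [simp]: "x \<in> cell xQ l k x"
  by (simp add: cell_def)

lemma cell_eq_iff: "cell xQ l k x = cell xQ l k y \<longleftrightarrow> y \<in> cell xQ l k x"
  by (auto simp: cell_def)

lemma cell_index_corner:
  assumes "l > 0"
  shows "cell_index xQ l k (xQ + (2 powi k * l) *\<^sub>R (\<chi> i. real_of_int (m $ i))) = m"
  using assms by (auto simp: cell_index_def vec_eq_iff)

lemma dyadic_cube_eq: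
  assumes "l > 0"
  shows "{xQ + (2 powi k * l) *\<^sub>R ((\<chi> i. real_of_int (m $ i)) + u) | u. \<forall>i. 0 \<le> u $ i \<and> u $ i < 1} =
    {y. cell_index xQ l k y = (m :: int ^ 'n)}" (is "?L = ?R")
proof -
  define h where "h = 2 powi k * l"
  have h: "h > 0" using assms by (simp add: h_def)
  show ?thesis
  proof (intro equalityI subsetI)
    fix y assume "y \<in> ?L"
    then obtain u where u: "\<forall>i. 0 \<le> u $ i \<and> u $ i < 1"
      and y: "y = xQ + h *\<^sub>R ((\<chi> i. real_of_int (m $ i)) + u)" by (auto simp: h_def)
    have "\<lfloor>(y $ i - xQ $ i) / h\<rfloor> = m $ i" for i
    proof -
      have "(y $ i - xQ $ i) / h = real_of_int (m $ i) + u $ i" using h by (simp add: y)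
      then show ?thesis using u by (simp add: floor_eq_iff)
    qed
    then show "y \<in> ?R" by (simp add: cell_index_def h_def vec_eq_iff)
  next
    fix y assume "y \<in> ?R"
    then have m: "\<lfloor>(y $ i - xQ $ i) / h\<rfloor> = m $ i" for i
      by (auto simp: cell_index_def h_def vec_eq_iff)
    define u :: "real ^ 'n" where "u = (\<chi> i. (y $ i - xQ $ i) / h - real_of_int (m $ i))"
    have "\<forall>i. 0 \<le> u $ i \<and> u $ i < 1"
    proof
      fix i show "0 \<le> u $ i \<and> u $ i < 1"
        using floor_correct[of "(y $ i - xQ $ i) / h"] m[of i] by (simp add: u_def)
    qed
    moreover have "y = xQ + h *\<^sub>R ((\<chi> i. real_of_int (m $ i)) + u)"
      using h by (simp add: vec_eq_iff u_def)
    ultimately show "y \<in> ?L" by (auto simp: h_def)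
  qed
qed

lemma finite_dyadic_cubes_eq:
  assumes "l > 0"
  shows "finite_dyadic_cubes xQ l = {cell xQ l k x | k x. True}"
proof -
  have "finite_dyadic_cubes xQ l = {P. \<exists>k m. P = {y. cell_index xQ l k y = m}}"
    unfolding finite_dyadic_cubes_def using dyadic_cube_eq[OF assms, of xQ] by simp
  also have "\<dots> = {cell xQ l k x | k x. True}"
    unfolding cell_def using cell_index_corner[OF assms, of xQ] by (auto, metis)
  finally show ?thesis .
qed

lemma countable_finite_dyadic_cubes:
  "countable (finite_dyadic_cubes xQ l)"
proof -
  have "finite_dyadic_cubes xQ l = range (\<lambda>(k, m).
    {xQ + (2 powi k * l) *\<^sub>R ((\<chi> i. real_of_int (m $ i)) + u) | u. \<forall>i. 0 \<le> u $ i \<and> u $ i < 1})"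
    by (auto simp: finite_dyadic_cubes_def image_iff)
  then show ?thesis by simp
qed

text \<open>Halving commutes with the floor once \<open>div\<close> rounds down, also for negative
  indices.\<close>

lemma cell_index_Suc:
  "cell_index xQ l (k + 1) y = (\<chi> i. cell_index xQ l k y $ i div 2)"
proof -
  have "\<lfloor>(y $ i - xQ $ i) / (2 powi (k + 1) * l)\<rfloor> = \<lfloor>(y $ i - xQ $ i) / (2 powi k * l)\<rfloor> div 2" for i
  proof -
    have "(y $ i - xQ $ i) / (2 powi (k + 1) * l) = (y $ i - xQ $ i) / (2 powi k * l) / real_of_int 2"
      by (subst power_int_add) auto
    then show ?thesis by (simp only: floor_divide_real_eq_div)
  qed
  then show ?thesis by (simp add: cell_index_def vec_eq_iff)
qed

lemma cell_mono:
  assumes "k \<le> k'"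
  shows "cell xQ l k x \<subseteq> cell xQ l k' x"
  using assms
proof (induction k' rule: int_ge_induct)
  case (step j)
  have "cell xQ l j x \<subseteq> cell xQ l (j + 1) x"
    by (auto simp: cell_def cell_index_Suc)
  then show ?case using step by blast
qed simp

text \<open>Two cells with a common point can both be based at that point, where
  \<open>cell_mono\<close> compares their generations.\<close>

lemma cell_nested:
  "cell xQ l k x \<subseteq> cell xQ l k' y \<or> cell xQ l k' y \<subseteq> cell xQ l k x \<or>
    cell xQ l k x \<inter> cell xQ l k' y = {}"
proof (cases "cell xQ l k x \<inter> cell xQ l k' y = {}")
  case False
  then obtain z where "z \<in> cell xQ l k x" "z \<in> cell xQ l k' y" by blast
  then have "cell xQ l k x = cell xQ l k z" "cell xQ l k' y = cell xQ l k' z"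
    by (auto simp: cell_eq_iff)
  then show ?thesis
    using cell_mono[of k k' xQ l z] cell_mono[of k' k xQ l z] by (cases "k \<le> k'") auto
qed simp

lemma cell_psubset_Suc:
  assumes "l > 0"
  shows "cell xQ l k x \<subset> cell xQ l (k + 1) x"
proof -
  define m where "m = cell_index xQ l k x"
  \<comment> \<open>The sibling obtained by flipping every coordinate within its pair of an even
    integer and its successor: same parent, different cell.\<close>
  define m' where "m' = (\<chi> i. if odd (m $ i) then m $ i - 1 else m $ i + 1)"
  obtain z where z: "cell_index xQ l k z = m'"
    using cell_index_corner[OF assms] by blast
  have "m' $ i div 2 = m $ i div 2" for i
    by (auto simp: m'_def elim!: oddE evenE)
  then have "z \<in> cell xQ l (k + 1) x"
    by (simp add: cell_def cell_index_Suc z m_def)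
  moreover have "m' $ i \<noteq> m $ i" for i by (simp add: m'_def)
  then have "m' \<noteq> m" by metis
  then have "z \<notin> cell xQ l k x"
    by (simp add: cell_def z m_def)
  ultimately show ?thesis
    using cell_mono[of k "k + 1" xQ l x] by auto
qed

lemma cell_component_dist:
  assumes "l > 0" "y \<in> cell xQ l k x" "z \<in> cell xQ l k x"
  shows "\<bar>y $ i - z $ i\<bar> < 2 powi k * l"
proof -
  define h where "h = 2 powi k * l"
  have h: "h > 0" using assms by (simp add: h_def)
  have "\<lfloor>(y $ i - xQ $ i) / h\<rfloor> = \<lfloor>(z $ i - xQ $ i) / h\<rfloor>"
    using assms by (auto simp: cell_def cell_index_def vec_eq_iff h_def)
  then have "\<bar>(y $ i - xQ $ i) / h - (z $ i - xQ $ i) / h\<bar> < 1" by linarith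
  also have "(y $ i - xQ $ i) / h - (z $ i - xQ $ i) / h = (y $ i - z $ i) / h"
    by (simp add: diff_divide_distrib)
  finally show ?thesis using h by (simp add: h_def[symmetric] abs_divide)
qed

text \<open>Cells are half-open, so coordinate differences stay strictly below the side; by
  comparison with the l1 norm, the open ball of radius exactly \<open>CARD('n)\<close> sides is
  enough.\<close>

lemma cell_subset_ball:
  fixes xQ :: "real ^ 'n"
  assumes "l > 0" "y \<in> cell xQ l k x" "e \<ge> real CARD('n) * (2 powi k * l)"
  shows "cell xQ l k x \<subseteq> ball y e"
proof
  fix z assume z: "z \<in> cell xQ l k x"
  have "dist y z \<le> (\<Sum>i\<in>UNIV. \<bar>(y - z) $ i\<bar>)"
    unfolding dist_norm by (rule norm_le_l1_cart)
  also have "\<dots> < (\<Sum>i\<in>(UNIV :: 'n set). 2 powi k * l)"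
    using cell_component_dist[OF assms(1,2) z] by (intro sum_strict_mono) auto
  finally show "z \<in> ball y e" using assms(3) by simp
qed

lemma cell_contains_ball:
  assumes "l > 0"
  obtains y where "ball y (2 powi k * l / 2) \<subseteq> cell xQ l k x" "y \<in> cell xQ l k x"
proof -
  define h where "h = 2 powi k * l"
  have h: "h > 0" using assms by (simp add: h_def)
  define m where "m = cell_index xQ l k x"
  define y where "y = (\<chi> i. xQ $ i + h * (real_of_int (m $ i) + 1/2))"
  have "ball y (h / 2) \<subseteq> cell xQ l k x"
  proof
    fix z assume z: "z \<in> ball y (h / 2)"
    have "\<lfloor>(z $ i - xQ $ i) / h\<rfloor> = m $ i" for i
    proof -
      have "\<bar>(z - y) $ i\<bar> < h / 2"
        using component_le_norm_cart[of "z - y" i] z by (simp add: dist_norm norm_minus_commute)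
      then have "\<bar>((z - y) $ i) / h\<bar> < 1 / 2" using h by (simp add: abs_divide field_simps)
      moreover have "(z $ i - xQ $ i) / h = ((z - y) $ i) / h + real_of_int (m $ i) + 1/2"
        using h by (simp add: y_def field_simps)
      ultimately show ?thesis by (simp only: floor_eq_iff) linarith
    qed
    then show "z \<in> cell xQ l k x"
      by (simp add: cell_def m_def[symmetric]) (simp add: cell_index_def h_def vec_eq_iff)
  qed
  moreover have "y \<in> ball y (h / 2)" using h by simp
  ultimately show thesis by (intro that[of y]) (auto simp: h_def)
qed

lemma cell_basis:
  fixes xQ :: "real ^ 'n"
  assumes "l > 0" "open U" "x \<in> U"
  obtains j where "j \<le> k" "cell xQ l j x \<subseteq> U"
proof -
  obtain e where e: "e > 0" "ball x e \<subseteq> U" using assms open_contains_ball by blast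
  define q where "q = e / (real CARD('n) * l)"
  have q: "q > 0" using e assms by (simp add: q_def)
  obtain n where n: "(1/2::real) ^ n < q"
    using real_arch_pow_inv[OF q, of "1/2"] by auto
  \<comment> \<open>The minimum with \<open>k\<close> keeps the small cell inside the cell of
    generation \<open>k\<close> at \<open>x\<close>.\<close>
  define j where "j = min k (- int n)"
  have "(2::real) powi j \<le> 2 powi (- int n)"
    by (rule power_int_increasing) (auto simp: j_def)
  also have "\<dots> = (1/2) ^ n" by (simp add: power_int_minus power_one_over inverse_eq_divide)
  finally have "2 powi j \<le> q" using n by simp
  then have "real CARD('n) * (2 powi j * l) \<le> e"
    using assms by (simp add: q_def field_simps)
  then have "cell xQ l j x \<subseteq> ball x e"
    using assms by (intro cell_subset_ball) auto
  then show thesis using e by (intro that[of j]) (auto simp: j_def)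
qed

text \<open>Every cell in between can be based at \<open>x\<close>, so only its generation is free;
  a generation outside \<open>{k..k'}\<close> forces it to equal one of the two ends.\<close>

lemma cell_finite_between:
  "finite {X. \<exists>j z. X = cell xQ l j z \<and> cell xQ l k x \<subseteq> X \<and> X \<subseteq> cell xQ l k' y}"
proof -
  let ?B = "{cell xQ l k x, cell xQ l k' y} \<union> (\<lambda>j. cell xQ l j x) ` {k..k'}"
  have "X \<in> ?B" if X: "X = cell xQ l j z" "cell xQ l k x \<subseteq> X" "X \<subseteq> cell xQ l k' y" for X j z
  proof -
    have x: "x \<in> X" "x \<in> cell xQ l k' y" using X(2,3) mem_cell_self[of x xQ l k] by blast+
    then have eq: "X = cell xQ l j x" "cell xQ l k' y = cell xQ l k' x"
      using X(1) by (auto simp: cell_eq_iff)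
    consider "j \<le> k" | "k' \<le> j" | "j \<in> {k..k'}" by fastforce
    then show ?thesis
    proof cases
      case 1
      then have "X = cell xQ l k x" using cell_mono[OF 1, of xQ l x] X(2) eq by blast
      then show ?thesis by blast
    next
      case 2
      then have "X = cell xQ l k' y" using cell_mono[OF 2, of xQ l x] X(3) eq by blast
      then show ?thesis by blast
    next
      case 3
      then show ?thesis using eq(1) by blast
    qed
  qed
  then have "{X. \<exists>j z. X = cell xQ l j z \<and> cell xQ l k x \<subseteq> X \<and> X \<subseteq> cell xQ l k' y} \<subseteq> ?B"
    by blast
  then show ?thesis by (rule finite_subset) simp
qed

text \<open>The point \<open>xQ\<close> is a grid point of every generation, so the sign of each
  coordinate relative to \<open>xQ\<close> is constant on a cell; it can be read off the
  floor.\<close>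

lemma infinite_dyadic_cube_cell:
  assumes "l > 0" "Q \<in> infinite_dyadic_cubes xQ" "z \<in> Q" "z \<in> cell xQ l k x"
  shows "cell xQ l k x \<subseteq> Q"
proof
  fix w assume w: "w \<in> cell xQ l k x"
  define h where "h = 2 powi k * l"
  have h: "h > 0" using assms by (simp add: h_def)
  obtain I where I: "\<forall>i. I i = {xQ $ i..} \<or> I i = {..<xQ $ i}" "Q = {y. \<forall>i. y $ i \<in> I i}"
    using assms by (auto simp: infinite_dyadic_cubes_def)
  have "w $ i \<ge> xQ $ i \<longleftrightarrow> z $ i \<ge> xQ $ i" for i
  proof -
    have sign: "v \<ge> xQ $ i \<longleftrightarrow> 0 \<le> \<lfloor>(v - xQ $ i) / h\<rfloor>" for v
      using h by (simp add: zero_le_floor zero_le_divide_iff)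
    have "\<lfloor>(w $ i - xQ $ i) / h\<rfloor> = \<lfloor>(z $ i - xQ $ i) / h\<rfloor>"
      using w assms(4) by (auto simp: cell_def cell_index_def vec_eq_iff h_def)
    then show ?thesis by (simp only: sign)
  qed
  then have "w $ i \<in> I i" for i
    using I assms(3) by (metis (mono_tags, lifting) atLeast_iff lessThan_iff mem_Collect_eq not_less)
  then show "w \<in> Q" using I by blast
qed

lemma doubling_iterate:
  assumes "\<And>x r. r > 0 \<Longrightarrow> C (ball x (2 * r)) \<le> ennreal D0 * C (ball x r)" "r > 0"
  shows "C (ball x (2 ^ j * r)) \<le> ennreal D0 ^ j * C (ball x r)"
proof (induction j)
  case (Suc j)
  have "C (ball x (2 ^ Suc j * r)) \<le> ennreal D0 * C (ball x (2 ^ j * r))"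
    using assms(1)[of "2 ^ j * r" x] assms(2) by (simp add: mult.assoc)
  also have "\<dots> \<le> ennreal D0 * (ennreal D0 ^ j * C (ball x r))"
    using Suc by (rule mult_left_mono) simp
  finally show ?case by (simp add: mult.assoc)
qed simp

subsection \<open>Choquet integrals and the dyadic packing tree\<close>

text \<open>The level set is \<open>E \<inter> A\<close> for levels below 1 and empty from 1
  on.\<close>

lemma choquet_indicator:
  assumes "C {} = 0"
  shows "choquet C A (indicator E) = C (E \<inter> A)"
proof -
  have "C {x \<in> A. indicator E x > ennreal t} * indicator {0..} t = C (E \<inter> A) * indicator {0..<1} t" for t
  proof (cases "t < 1")
    case True
    have "{x \<in> A. indicator E x > ennreal t} = E \<inter> A"
      using True by (auto simp: indicator_def)
    then show ?thesis using True by (auto simp: indicator_def)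
  next
    case False
    then have empty: "{x \<in> A. indicator E x > ennreal t} = {}"
      by (auto simp: indicator_def)
    show ?thesis unfolding empty using False assms by simp
  qed
  then have "choquet C A (indicator E) = (\<integral>\<^sup>+ (t::real). C (E \<inter> A) * indicator {0..<1} t \<partial>lborel)"
    by (simp only: choquet_def)
  also have "\<dots> = C (E \<inter> A)"
    by (subst nn_integral_cmult_indicator) auto
  finally show ?thesis .
qed

text \<open>Level sets decrease in the level, so on \<open>{0..<r}\<close> the integrand is at least
  the capacity at level \<open>r\<close>.\<close>

lemma choquet_markov:
  assumes mono: "\<And>A B. A \<subseteq> B \<Longrightarrow> C A \<le> C B" and r: "r > 0"
  shows "ennreal r * C {x \<in> A. \<bar>f x - c\<bar> > r} \<le> choquet C A (\<lambda>x. ennreal \<bar>f x - c\<bar>)"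
proof -
  let ?L = "{x \<in> A. \<bar>f x - c\<bar> > r}"
  have "ennreal r * C ?L = (\<integral>\<^sup>+ t. C ?L * indicator {0..<r} t \<partial>lborel)"
    using r by (subst nn_integral_cmult_indicator) (auto simp: mult.commute)
  also have "\<dots> \<le> choquet C A (\<lambda>x. ennreal \<bar>f x - c\<bar>)"
    unfolding choquet_def
  proof (rule nn_integral_mono)
    fix t
    have "C ?L \<le> C {x \<in> A. ennreal \<bar>f x - c\<bar> > ennreal t}" if "t \<in> {0..<r}"
      using that by (intro mono) (auto simp: ennreal_less_iff)
    then show "C ?L * indicator {0..<r} t \<le> C {x \<in> A. ennreal t < ennreal \<bar>f x - c\<bar>} * indicator {0..} t"
      by (auto simp: indicator_def)
  qed
  finally show ?thesis .
qed

lemma (in packing_tree) osc_boundI: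
  assumes "R \<in> T" "mean_deviation C R f c \<le> ennreal K"
  shows "osc_bound f K R c"
proof -
  have "choquet C R (\<lambda>x. ennreal \<bar>f x - c\<bar>) = mean_deviation C R f c * C R"
    unfolding mean_deviation_def choquet_average_def
    using pos[OF assms(1)] fin[OF assms(1)]
    by (simp add: ennreal_divide_times ennreal_mult_divide_eq)
  also have "\<dots> \<le> ennreal K * C R"
    using assms(2) by (rule mult_right_mono) simp
  finally show ?thesis
    unfolding osc_bound_def using choquet_markov[of C] outer_capacity_mono[OF capacity]
    by (meson order_trans)
qed

text \<open>Doubling makes all dilates of a null ball null, and countably many of them cover the
  space.\<close>

lemma doubling_capacity_ball_pos:
  fixes C :: "('a::metric_space) set \<Rightarrow> ennreal"
  assumes cap: "outer_capacity C" and dbl: "doubling_capacity C" and "C UNIV \<noteq> 0" and r: "r > 0"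
  shows "C (ball x r) > 0"
proof (rule ccontr)
  assume "\<not> ?thesis"
  then have z: "C (ball x r) = 0" by simp
  obtain D0 where D0: "\<And>x r. r > 0 \<Longrightarrow> C (ball x (2 * r)) \<le> ennreal D0 * C (ball x r)"
    using dbl unfolding doubling_capacity_def by blast
  have zero: "C (ball x (2 ^ j * r)) = 0" for j
    using doubling_iterate[OF D0 r, of x j] z by simp
  have "UNIV \<subseteq> (\<Union>j. ball x (2 ^ j * r))"
  proof
    fix y
    obtain j where "dist x y / r < 2 ^ j" using real_arch_pow[of 2] by auto
    then have "y \<in> ball x (2 ^ j * r)" using r by (simp add: field_simps)
    then show "y \<in> (\<Union>j. ball x (2 ^ j * r))" by blast
  qed
  then have "C UNIV \<le> (\<Sum>j. C (ball x (2 ^ j * r)))"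
    by (rule outer_capacity_subadditive[OF cap])
  also have "\<dots> = 0" by (simp add: zero)
  finally show False using assms(3) by simp
qed

text \<open>Outer regularity gives an open set of finite capacity around \<open>S\<close>, hence a
  small ball of finite capacity; some dilate of it contains the given ball.\<close>

lemma doubling_capacity_ball_finite:
  fixes C :: "('a::metric_space) set \<Rightarrow> ennreal"
  assumes cap: "outer_capacity C" and dbl: "doubling_capacity C" and S: "S \<noteq> {}" "C S < \<infinity>"
  shows "C (ball y r) < \<infinity>"
proof -
  obtain D0 where D0: "\<And>x r. r > 0 \<Longrightarrow> C (ball x (2 * r)) \<le> ennreal D0 * C (ball x r)"
    using dbl unfolding doubling_capacity_def by blast
  have "(INF U\<in>{U. S \<subseteq> U \<and> open U}. C U) < \<infinity>"
    using S(2) outer_capacity_regular[OF cap, of S] by simp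
  then obtain U where U: "S \<subseteq> U" "open U" "C U < \<infinity>" by (auto simp: INF_less_iff)
  obtain x where "x \<in> U" using S U by blast
  then obtain e where e: "e > 0" "ball x e \<subseteq> U" using U open_contains_ball by blast
  have fin: "C (ball x e) < \<infinity>"
    using outer_capacity_mono[OF cap e(2)] U(3) by auto
  obtain j where j: "(dist x y + r) / e < 2 ^ j" using real_arch_pow[of 2] by auto
  have "ball y r \<subseteq> ball x (2 ^ j * e)"
  proof
    fix z assume "z \<in> ball y r"
    then have "dist x z < dist x y + r" using dist_triangle[of x z y] by simp
    also have "\<dots> < 2 ^ j * e" using j e by (simp add: field_simps)
    finally show "z \<in> ball x (2 ^ j * e)" by simp
  qed
  then have "C (ball y r) \<le> C (ball x (2 ^ j * e))" by (rule outer_capacity_mono[OF cap])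
  also have "\<dots> \<le> ennreal D0 ^ j * C (ball x e)" by (rule doubling_iterate[OF D0 e(1)])
  also have "\<dots> < \<infinity>" using fin by (simp add: ennreal_mult_less_top power_less_top_ennreal)
  finally show ?thesis .
qed

text \<open>The cell contains a ball of half its side, and the parent lies within
  \<open>CARD('n)\<close> times twice the side of that ball's centre. The ratio of the radii,
  \<open>4 * CARD('n)\<close>, is absorbed by \<open>j\<close> doublings.\<close>

lemma cell_doubling:
  fixes xQ :: "real ^ 'n"
  assumes cap: "outer_capacity C" and l: "l > 0"
    and D0: "\<And>x r. r > 0 \<Longrightarrow> C (ball x (2 * r)) \<le> ennreal D0 * C (ball x r)"
    and j: "4 * real CARD('n) \<le> 2 ^ j"
  shows "C (cell xQ l (k + 1) x) \<le> ennreal D0 ^ j * C (cell xQ l k x)"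
proof -
  obtain y where y: "ball y (2 powi k * l / 2) \<subseteq> cell xQ l k x" "y \<in> cell xQ l k x"
    by (rule cell_contains_ball[OF l])
  have y': "y \<in> cell xQ l (k + 1) x" using cell_mono[of k "k + 1" xQ l x] y(2) by auto
  have "real CARD('n) * (2 powi (k + 1) * l) = 4 * real CARD('n) * (2 powi k * l / 2)"
    by (subst power_int_add) auto
  also have "\<dots> \<le> 2 ^ j * (2 powi k * l / 2)"
    using j l by (intro mult_right_mono) auto
  finally have "cell xQ l (k + 1) x \<subseteq> ball y (2 ^ j * (2 powi k * l / 2))"
    by (intro cell_subset_ball[OF l y'])
  then have "C (cell xQ l (k + 1) x) \<le> C (ball y (2 ^ j * (2 powi k * l / 2)))"
    by (rule outer_capacity_mono[OF cap])
  also have "\<dots> \<le> ennreal D0 ^ j * C (ball y (2 powi k * l / 2))"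
    by (rule doubling_iterate[OF D0]) (use l in auto)
  also have "\<dots> \<le> ennreal D0 ^ j * C (cell xQ l k x)"
    by (intro mult_left_mono outer_capacity_mono[OF cap y(1)]) auto
  finally show ?thesis .
qed

lemma packing_tree_dyadic:
  fixes C :: "(real ^ 'n) set \<Rightarrow> ennreal"
  assumes l: "l > 0" and cap: "outer_capacity C" and S0: "S0 \<noteq> {}" "C S0 < \<infinity>"
    and pack: "packing_assumption C xQ l" and dbl: "doubling_capacity C" and nz: "C UNIV \<noteq> 0"
  shows "\<exists>D A0. packing_tree C (finite_dyadic_cubes xQ l) D A0"
proof -
  let ?T = "finite_dyadic_cubes xQ l"
  have T: "?T = {cell xQ l k x | k x. True}" by (rule finite_dyadic_cubes_eq[OF l])
  obtain D0 where D0: "\<And>x r. r > 0 \<Longrightarrow> C (ball x (2 * r)) \<le> ennreal D0 * C (ball x r)"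
    using dbl unfolding doubling_capacity_def by blast
  obtain j where j: "4 * real CARD('n) < 2 ^ j" using real_arch_pow[of 2] by auto
  \<comment> \<open>\<open>ennreal\<close> sends negative reals to 0, so \<open>max 0 D0\<close>
    stands for the same factor; the outer maximum secures \<open>D \<ge> 1\<close>.\<close>
  define D where "D = max 1 (max 0 D0 ^ j)"
  have D: "ennreal D0 ^ j \<le> ennreal D"
  proof -
    have "ennreal D0 ^ j = ennreal (max 0 D0) ^ j" by (simp add: max_def ennreal_neg)
    also have "\<dots> = ennreal (max 0 D0 ^ j)" by (rule ennreal_power) simp
    finally show ?thesis by (simp only: D_def) (intro ennreal_leI, simp)
  qed
  obtain A0 :: real where A0: "A0 \<ge> 1" and
    A0_all: "\<forall>\<F> \<subseteq> dyadic_cubes xQ l. non_overlapping \<F> \<longrightarrow>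
      (\<forall>Q' \<in> dyadic_cubes xQ l. (\<Sum>\<^sub>\<infinity>P\<in>{P \<in> \<F>. P \<subseteq> Q'}. C P) \<le> ennreal A0 * C Q') \<longrightarrow>
      (\<forall>f :: real ^ 'n \<Rightarrow> ennreal.
        (\<Sum>\<^sub>\<infinity>P\<in>\<F>. choquet C P f) \<le> ennreal A0 * choquet C (\<Union>\<F>) f)"
    using pack unfolding packing_assumption_def by (elim exE conjE)
  note A0_pack = A0_all[rule_format]
  have "packing_tree C ?T D A0"
  proof
    show "X \<subseteq> Y \<or> Y \<subseteq> X \<or> X \<inter> Y = {}" if XY: "X \<in> ?T" "Y \<in> ?T" for X Y
    proof -
      obtain k x k' y where "X = cell xQ l k x" "Y = cell xQ l k' y"
        using XY by (auto simp: T)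
      then show ?thesis using cell_nested by metis
    qed
    show "finite {X \<in> ?T. R \<subseteq> X \<and> X \<subseteq> P}" if "R \<in> ?T" "P \<in> ?T" for R P
    proof -
      obtain k x k' y where "R = cell xQ l k x" "P = cell xQ l k' y" using \<open>R \<in> ?T\<close> \<open>P \<in> ?T\<close> T by auto
      then show ?thesis
        using cell_finite_between[of xQ l k x k' y] unfolding T by (rule_tac finite_subset) auto
    qed
    show "\<exists>X\<in>?T. R \<subset> X \<and> X \<subseteq> P \<and> C X \<le> ennreal D * C R"
      if RP: "R \<in> ?T" "P \<in> ?T" "R \<subset> P" for R P
    proof -
      obtain k x where R: "R = cell xQ l k x" using RP T by auto
      obtain k' y where "P = cell xQ l k' y" using RP T by auto
      moreover have "x \<in> P" using RP R mem_cell_self by blast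
      ultimately have P: "P = cell xQ l k' x" by (simp add: cell_eq_iff)
      have "k < k'"
      proof (rule ccontr)
        assume "\<not> k < k'"
        then show False using cell_mono[of k' k xQ l x] RP(3) R P by auto
      qed
      then have "cell xQ l (k + 1) x \<subseteq> P" unfolding P by (intro cell_mono) auto
      moreover have "R \<subset> cell xQ l (k + 1) x" unfolding R by (rule cell_psubset_Suc[OF l])
      moreover have "C (cell xQ l (k + 1) x) \<le> ennreal D * C R"
        using cell_doubling[OF cap l D0 less_imp_le[OF j], of xQ k x] mult_right_mono[OF D, of "C R"]
        unfolding R by simp
      moreover have "cell xQ l (k + 1) x \<in> ?T" unfolding T by blast
      ultimately show ?thesis by blast
    qed
    show "\<exists>R\<in>?T. x \<in> R \<and> R \<subseteq> U \<inter> P" if PU: "P \<in> ?T" "open U" "x \<in> P" "x \<in> U" for P U x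
    proof -
      obtain k y where "P = cell xQ l k y" using PU(1) T by auto
      then have P: "P = cell xQ l k x" using PU(3) by (simp add: cell_eq_iff)
      obtain i where "i \<le> k" "cell xQ l i x \<subseteq> U" by (rule cell_basis[OF l PU(2,4)])
      then have "cell xQ l i x \<subseteq> U \<inter> P" using cell_mono[of i k xQ l x] P by blast
      moreover have "cell xQ l i x \<in> ?T" unfolding T by blast
      ultimately show ?thesis using mem_cell_self[of x xQ l i] by blast
    qed
    show "0 < C R" if RT: "R \<in> ?T" for R
    proof -
      obtain k x where R: "R = cell xQ l k x" using RT T by auto
      obtain y where y: "ball y (2 powi k * l / 2) \<subseteq> cell xQ l k x" "y \<in> cell xQ l k x"
        by (rule cell_contains_ball[OF l])
      have "0 < C (ball y (2 powi k * l / 2))"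
        using l by (intro doubling_capacity_ball_pos[OF cap dbl nz]) auto
      also have "\<dots> \<le> C R" unfolding R by (rule outer_capacity_mono[OF cap y(1)])
      finally show ?thesis .
    qed
    show "C R < \<infinity>" if RT: "R \<in> ?T" for R
    proof -
      obtain k x where R: "R = cell xQ l k x" using RT T by auto
      have "R \<subseteq> ball x (real CARD('n) * (2 powi k * l))"
        unfolding R by (rule cell_subset_ball[OF l]) auto
      then have "C R \<le> C (ball x (real CARD('n) * (2 powi k * l)))"
        by (rule outer_capacity_mono[OF cap])
      also have "\<dots> < \<infinity>" by (rule doubling_capacity_ball_finite[OF cap dbl S0])
      finally show ?thesis .
    qed
    show "(\<Sum>\<^sub>\<infinity>R\<in>S. C (E \<inter> R)) \<le> ennreal A0 * C (E \<inter> \<Union>S)"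
      if P: "P \<in> ?T" and S: "S \<subseteq> ?T" and SP: "\<Union>S \<subseteq> P" and disj: "pairwise disjnt S"
        and packed: "packed C ?T S" for P S E
    proof -
      have le: "C Q \<le> ennreal A0 * C Q" for Q
        using mult_right_mono[of 1 "ennreal A0" "C Q"] A0 by simp
      have "(\<Sum>\<^sub>\<infinity>R\<in>S. choquet C R (indicator E)) \<le> ennreal A0 * choquet C (\<Union>S) (indicator E)"
      proof (rule A0_pack)
        show "S \<subseteq> dyadic_cubes xQ l" using S by (auto simp: dyadic_cubes_def)
        show "non_overlapping S"
          unfolding non_overlapping_def
        proof (rule pairwise_mono[OF disj])
          fix X Y :: "(real ^ 'n) set" assume "disjnt X Y"
          then show "interior X \<inter> interior Y = {}"
            using interior_subset[of X] interior_subset[of Y] by (auto simp: disjnt_def)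
        qed simp
        fix Q assume Q: "Q \<in> dyadic_cubes xQ l"
        have "infsum C {R \<in> S. R \<subseteq> Q} \<le> C Q"
        proof (cases "Q \<in> ?T")
          case True
          then show ?thesis by (rule packed_infsum_le[OF packed])
        next
          case False
          \<comment> \<open>Infinite cubes are not tested by \<open>packed\<close>. If such a cube
            contains a member of \<open>S\<close>, then it contains all of \<open>P\<close>, and the
            sum is at most \<open>C P\<close>.\<close>
          then have Qinf: "Q \<in> infinite_dyadic_cubes xQ" using Q by (auto simp: dyadic_cubes_def)
          show ?thesis
          proof (cases "{R \<in> S. R \<subseteq> Q} = {}")
            case False
            then obtain R where R: "R \<in> S" "R \<subseteq> Q" by blast
            then obtain i z where z: "R = cell xQ l i z" using S T by auto
            obtain k x where Px: "P = cell xQ l k x" using P T by auto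
            have zin: "z \<in> Q" "z \<in> cell xQ l k x" using z R SP Px mem_cell_self[of z xQ l i] by blast+
            have PQ: "P \<subseteq> Q" unfolding Px by (rule infinite_dyadic_cube_cell[OF l Qinf zin])
            have "{R \<in> S. R \<subseteq> Q} = {R \<in> S. R \<subseteq> P}" using SP PQ by blast
            then have "infsum C {R \<in> S. R \<subseteq> Q} \<le> C P" using packed_infsum_le[OF packed P] by simp
            also have "\<dots> \<le> C Q" by (rule outer_capacity_mono[OF cap PQ])
            finally show ?thesis .
          next
            case True
            show ?thesis unfolding True by simp
          qed
        qed
        then show "infsum C {R \<in> S. R \<subseteq> Q} \<le> ennreal A0 * C Q"
          using le[of Q] by (rule order.trans)
      qed
      then show ?thesis by (simp add: choquet_indicator outer_capacity_empty[OF cap])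
    qed
  qed (use cap A0 countable_finite_dyadic_cubes in \<open>auto simp: D_def\<close>)
  then show ?thesis by blast
qed

section \<open>From the essential supremum to a bound on every cube, and the theorem\<close>

lemma dyadic_cubes_lebesgue:
  fixes xQ :: "real ^ 'n"
  assumes l: "l > 0" and "Q0 \<in> dyadic_cubes xQ l"
  shows "Q0 \<in> sets lebesgue"
proof -
  have coord: "{y :: real ^ 'n. \<forall>i. y $ i \<in> I i} \<in> sets borel" if "\<And>i. I i \<in> sets borel" for I :: "'n \<Rightarrow> real set"
  proof -
    have "{y :: real ^ 'n. \<forall>i. y $ i \<in> I i} = (\<Inter>i. (\<lambda>y. y $ i) -` I i)" by auto
    also have "\<dots> \<in> sets borel"
    proof (rule sets.finite_INT)
      fix i
      have m: "(\<lambda>y :: real ^ 'n. y $ i) \<in> borel_measurable borel"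
        by (intro borel_measurable_continuous_onI continuous_intros)
      show "(\<lambda>y :: real ^ 'n. y $ i) -` I i \<in> sets borel"
        using measurable_sets[OF m that[of i]] by simp
    qed auto
    finally show ?thesis .
  qed
  have "Q0 \<in> sets borel"
  proof (cases "Q0 \<in> finite_dyadic_cubes xQ l")
    case True
    then obtain k x where Q0: "Q0 = cell xQ l k x" unfolding finite_dyadic_cubes_eq[OF l] by blast
    define h where "h = 2 powi k * l"
    define m where "m = cell_index xQ l k x"
    have h: "h > 0" using l by (simp add: h_def)
    have "\<lfloor>(v - xQ $ i) / h\<rfloor> = m $ i \<longleftrightarrow> v \<in> {xQ $ i + h * m $ i ..< xQ $ i + h * (m $ i + 1)}" for v i
      using h by (auto simp: floor_eq_iff field_simps)
    then have "Q0 = {y. \<forall>i. y $ i \<in> {xQ $ i + h * m $ i ..< xQ $ i + h * (m $ i + 1)}}"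
      unfolding Q0 cell_def m_def[symmetric] by (simp add: cell_index_def h_def vec_eq_iff)
    then show ?thesis using coord by simp
  next
    case False
    then have "Q0 \<in> infinite_dyadic_cubes xQ" using assms by (simp add: dyadic_cubes_def)
    then obtain I where I: "\<forall>i. I i = {xQ $ i..} \<or> I i = {..<xQ $ i}" "Q0 = {y. \<forall>i. y $ i \<in> I i}"
      by (auto simp: infinite_dyadic_cubes_def)
    have "I i \<in> sets borel" for i using I(1)[rule_format, of i] by (elim disjE) simp_all
    then show ?thesis using coord I(2) by simp
  qed
  then show ?thesis by simp
qed

text \<open>The norm bounds the sharp maximal function almost everywhere on \<open>Q0\<close>. As
  \<open>R\<close> contains a ball of positive measure, the bound holds at some point of
  \<open>R\<close>, and \<open>R\<close> is one of the cubes in the supremum at that point.\<close>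

lemma INF_mean_deviation_le_bmo_norm:
  fixes xQ :: "real ^ 'n"
  assumes l: "l > 0" and Q0: "Q0 \<in> dyadic_cubes xQ l"
    and R: "R \<in> finite_dyadic_cubes xQ l" "R \<subseteq> Q0"
  shows "(INF c. mean_deviation C R f c) \<le> bmo_norm C xQ l Q0 f"
proof -
  let ?N = "bmo_norm C xQ l Q0 f"
  have "AE x in lebesgue_on Q0. sharp_maximal C xQ l Q0 f x \<le> ?N"
    unfolding bmo_norm_def by (rule esssup_AE)
  then have ae: "AE x in lebesgue. x \<in> Q0 \<longrightarrow> sharp_maximal C xQ l Q0 f x \<le> ?N"
    using dyadic_cubes_lebesgue[OF l Q0] by (subst (asm) AE_restrict_space_iff) auto
  obtain k x where Rx: "R = cell xQ l k x" using R(1) unfolding finite_dyadic_cubes_eq[OF l] by blast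
  obtain y where y: "ball y (2 powi k * l / 2) \<subseteq> R" "y \<in> R"
    unfolding Rx by (rule cell_contains_ball[OF l])
  have "\<exists>x\<in>R. sharp_maximal C xQ l Q0 f x \<le> ?N"
  proof (rule ccontr)
    assume no: "\<not> ?thesis"
    from ae have "AE x in lebesgue. x \<notin> ball y (2 powi k * l / 2)"
    proof (rule AE_mp, intro AE_I2 impI)
      fix x assume "x \<in> Q0 \<longrightarrow> sharp_maximal C xQ l Q0 f x \<le> ?N"
      then show "x \<notin> ball y (2 powi k * l / 2)" using no y R by blast
    qed
    then have "negligible (ball y (2 powi k * l / 2))"
      by (simp add: negligible_iff_null_sets AE_iff_null_sets)
    moreover have "0 < 2 powi k * l / 2" using l by simp
    ultimately show False
      using open_not_negligible[of "ball y (2 powi k * l / 2)"] by (metis ball_eq_empty not_less open_ball)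
  qed
  then obtain z where z: "z \<in> R" "sharp_maximal C xQ l Q0 f z \<le> ?N" by blast
  have "R \<in> {P \<in> dyadic_subcubes xQ l Q0. z \<in> P}"
    using R z by (auto simp: dyadic_subcubes_def dyadic_cubes_def)
  then have "(INF c. mean_deviation C R f c) \<le> sharp_maximal C xQ l Q0 f z"
    unfolding sharp_maximal_def by (rule SUP_upper)
  then show ?thesis using z(2) by (rule order.trans)
qed

theorem theorem4:
  fixes C :: "(real ^ 'n) set \<Rightarrow> ennreal"
    and xQ :: "real ^ 'n" and l :: real and Q0 :: "(real ^ 'n) set"
  assumes "l > 0"
    and "outer_capacity C"
    and "\<exists>S. S \<noteq> {} \<and> C S < \<infinity>"
    and "packing_assumption C xQ l"
    and "doubling_capacity C"
    and "Q0 \<in> dyadic_cubes xQ l"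
  shows "\<exists>a A :: real. a > 0 \<and> A > 0 \<and>
    (\<forall>t > 0. \<forall>f \<in> BMO C xQ l Q0.
       \<forall>Q' \<in> dyadic_subcubes xQ l Q0 \<inter> finite_dyadic_cubes xQ l.
         \<forall>c. is_arg_min (mean_deviation C Q' f) (\<lambda>_. True) c \<longrightarrow>
           C {x \<in> Q'. \<bar>f x - c\<bar> > t}
             \<le> ennreal A * C Q' * exp_decay a t (bmo_norm C xQ l Q0 f))"
\<comment> \<open>If the whole space is null, both sides vanish. Otherwise doubling makes every
  finite cube positive, as \<open>packing_tree\<close> demands.\<close>
proof (cases "C UNIV = 0")
  case True
  have "C X = 0" for X
    using outer_capacity_mono[OF assms(2), of X UNIV] True by simp
  then show ?thesis by (intro exI[of _ 1]) simp
next
  case False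
  obtain D A0 where tree: "packing_tree C (finite_dyadic_cubes xQ l) D A0"
    using packing_tree_dyadic[OF assms(1,2) _ _ assms(4,5) False] assms(3) by blast
  interpret packing_tree C "finite_dyadic_cubes xQ l" D A0 by (rule tree)
  \<comment> \<open>\<open>B\<close> depends only on the constants of the tree, so one rate serves
    all \<open>t\<close>, \<open>f\<close> and \<open>Q'\<close>.\<close>
  define B where "B = 16 * A0\<^sup>2 * D + 2"
  have B: "B > 0" unfolding B_def using A0_ge D_ge by (intro add_nonneg_pos) auto
  have "C {x \<in> Q'. \<bar>f x - c\<bar> > t} \<le> ennreal 2 * C Q' * exp_decay (ln 2 / (2 * B)) t (bmo_norm C xQ l Q0 f)"
    if t: "t > 0" and f: "f \<in> BMO C xQ l Q0"
      and Q': "Q' \<in> dyadic_subcubes xQ l Q0 \<inter> finite_dyadic_cubes xQ l"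
      and c: "is_arg_min (mean_deviation C Q' f) (\<lambda>_. True) c" for t f Q' c
  proof -
    define N where "N = bmo_norm C xQ l Q0 f"
    have Q'T: "Q' \<in> finite_dyadic_cubes xQ l" "Q' \<subseteq> Q0" using Q' by (auto simp: dyadic_subcubes_def)
    have inf_le: "(INF c. mean_deviation C R f c) \<le> N" if "R \<in> finite_dyadic_cubes xQ l" "R \<subseteq> Q0" for R
      unfolding N_def by (rule INF_mean_deviation_le_bmo_norm[OF assms(1,6) that])
    have "mean_deviation C Q' f c \<le> (INF c. mean_deviation C Q' f c)"
      using c by (intro INF_greatest) (auto simp: is_arg_min_def not_less)
    then have cN: "mean_deviation C Q' f c \<le> N" using inf_le[OF Q'T] by (rule order.trans)
    have "N < \<infinity>" using f by (simp add: BMO_def N_def)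
    then obtain \<nu> where \<nu>: "N = ennreal \<nu>" "\<nu> \<ge> 0" by (cases N) auto
    show ?thesis
    proof (cases "\<nu> = 0")
      \<comment> \<open>Here \<open>exp_decay\<close> is 0, so the level set has to be null: the
        minimizer has mean deviation 0, and \<open>osc_bound\<close> with \<open>K = 0\<close> says
        exactly this.\<close>
      case True
      then have "osc_bound f 0 Q' c"
        using cN \<nu> by (intro osc_boundI[OF Q'T(1)]) simp
      then have "C {x \<in> Q'. \<bar>f x - c\<bar> > t} = 0"
        using osc_boundD[of f 0 Q' c t] t by simp
      then show ?thesis by simp
    next
      case False
      then have pos': "\<nu> > 0" using \<nu> by simp
      \<comment> \<open>On subcubes the infimum over centres is not assumed to be attained. The
        slack from \<open>\<nu>\<close> to \<open>2 * \<nu>\<close> provides near-minimizers and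
        accounts for the 2 in the rate \<open>ln 2 / (2 * B)\<close>.\<close>
      have N2: "N < ennreal (2 * \<nu>)" using \<nu> pos' by (simp add: ennreal_less_iff)
      have "\<exists>c. osc_bound f (2 * \<nu>) R c" if R: "R \<in> finite_dyadic_cubes xQ l" "R \<subseteq> Q'" for R
      proof -
        have "(INF c. mean_deviation C R f c) < ennreal (2 * \<nu>)"
          by (rule order.strict_trans1[OF inf_le[OF R(1) subset_trans[OF R(2) Q'T(2)]] N2])
        then obtain c' where "mean_deviation C R f c' < ennreal (2 * \<nu>)" by (auto simp: INF_less_iff)
        then show ?thesis using osc_boundI[OF R(1)] less_imp_le by blast
      qed
      moreover have "osc_bound f (2 * \<nu>) Q' c"
        using cN N2 by (intro osc_boundI[OF Q'T(1)]) simp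
      ultimately have "C {x \<in> Q'. \<bar>f x - c\<bar> > t} \<le>
          ennreal 2 * C Q' * ennreal (exp (- (ln 2 / B) * t / (2 * \<nu>)))"
        unfolding B_def using t pos' Q'T(1) by (intro john_nirenberg) auto
      also have "- (ln 2 / B) * t / (2 * \<nu>) = - (ln 2 / (2 * B)) * t / \<nu>" by simp
      finally show ?thesis
        using \<nu> pos' by (simp add: exp_decay_def N_def[symmetric] del: mult_minus_left)
    qed
  qed
  then show ?thesis
    using B by (intro exI[of _ "ln 2 / (2 * B)"] exI[of _ 2]) auto
qed

end
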